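(* Let $\alpha\in(0,1/2)$, $N=n^\alpha$, $R=\log(n)$, and let $(Y^\pi_i,Z^\pi_i)_{0\le i\le n}$ be the solution of the discrete scheme described in the context. There is a constant $C$ not depending on $n$ such that, for $n$ large enough, $$\sup_{0\le i\le n}\Big(|Y^\pi_i|+\mathbb E_{t_i}\Big[\sum_{k=i}^{n-1}|Z^\pi_k|^2h_k\Big]\Big)\le C.$$
   Context: Fix $T>0$, $d\ge1$, and a probability space $(\Omega,\mathcal A,\mathbb P)$ carrying a $d$-dimensional Brownian motion $W$ (a column vector) with Brownian filtration $(\mathcal F_t)_{0\le t\le T}$; write $\mathbb E_t[\cdot]=\mathbb E[\cdot|\mathcal F_t]$. Let $K,L>0$ be constants. The functions $b:\mathbb R^d\to\mathbb R^d$, $\sigma:\mathbb R^d\to\mathbb R^{d\times d}$ are $K$-Lipschitz, $g:\mathbb R^d\to\mathbb R$ is bounded and $K$-Lipschitz, and $f:\mathbb R^d\times\mathbb R\times\mathbb R^{1\times d}\to\mathbb R$ satisfies, for all arguments, $|f(x_1,y_1,z)-f(x_2,y_2,z)|\le K(|x_1-x_2|+|y_1-y_2|)$, $|f(x,y,z)-f(x,y,z')|\le L(1+|z|+|z'|)|z-z'|$ and $|f(x,y,z)|\le L(1+|y|+|z|^2)$. For $N>0$, $f_N(x,y,z)=f(x,y,\varphi_N(z))$, where $\varphi_N$ is the projection on the centered Euclidean ball of radius $\rho N$ and the fixed constant $\rho>0$ is chosen such that $f_N$ is $N$-Lipschitz in $z$. Grid: for each $n$, $\pi=\{0=t_0<t_1<\dots<t_n=T\}$,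 $h_i=t_{i+1}-t_i$, $h=\max_i h_i$; there are constants $c_1,c_2>0$ and $\theta\ge1$ independent of $n$ with $hn\le c_1$ and $h_in^\theta\ge c_2$ for $0\le i<n$. Scheme: given $x\in\mathbb R^d$, $X^\pi_0=x$, $X^\pi_{i+1}=X^\pi_i+b(X^\pi_i)h_i+\sigma(X^\pi_i)(W_{t_{i+1}}-W_{t_i})$. The row vectors $H^R_i\in\mathbb R^{1\times d}$ have components $(H^R_i)^\ell=\frac{-R}{\sqrt{h_i}}\vee\frac{W^\ell_{t_{i+1}}-W^\ell_{t_i}}{h_i}\wedge\frac{R}{\sqrt{h_i}}$, $1\le\ell\le d$. Then $(Y^\pi_n,Z^\pi_n)=(g(X^\pi_n),0)$ and, for $i<n$, $$Y^\pi_i=\mathbb E_{t_i}[Y^\pi_{i+1}+h_if_N(X^\pi_i,Y^\pi_i,Z^\pi_i)],\qquad Z^\pi_i=\mathbb E_{t_i}[Y^\pi_{i+1}H^R_i].$$ *)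

theory Defs
  imports "HOL-Probability.Probability"
begin

(* Vectors of R^d and R^{1 x d} are elements of real ^ 'd, so d = CARD('d) >= 1; the norm on
   real ^ 'd ^ 'd is the Frobenius norm. *)

text \<open>
  The filtration generated by \<open>W\<close>, augmented by the null sets of \<open>M\<close>
  (for complete \<open>M\<close> this is the usual augmentation).
\<close>

definition brownian_filtration ::
  "'a measure \<Rightarrow> (real \<Rightarrow> 'a \<Rightarrow> real ^ 'd) \<Rightarrow> real \<Rightarrow> 'a measure"
where
  "brownian_filtration M W t =
     sigma (space M)
       ({W s -` A \<inter> space M | s A. s \<in> {0..t} \<and> A \<in> sets borel} \<union> null_sets M)"

locale brownian_motion = prob_space M
  for M :: "'a measure" and W :: "real \<Rightarrow> 'a \<Rightarrow> real ^ 'd" and T :: real +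
  assumes random_variable_W: "\<And>t. t \<in> {0..T} \<Longrightarrow> random_variable borel (W t)"
    and W_zero: "AE \<omega> in M. W 0 \<omega> = 0"
    and continuous_paths: "AE \<omega> in M. continuous_on {0..T} (\<lambda>t. W t \<omega>)"
    and gaussian_increments: "\<And>s t. 0 \<le> s \<Longrightarrow> s < t \<Longrightarrow> t \<le> T \<Longrightarrow>
      distributed M lborel (\<lambda>\<omega>. W t \<omega> - W s \<omega>)
        (\<lambda>x. ennreal (\<Prod>l\<in>UNIV. normal_density 0 (sqrt (t - s)) (x $ l)))"
    and independent_increments: "\<And>s t. 0 \<le> s \<Longrightarrow> s < t \<Longrightarrow> t \<le> T \<Longrightarrow>
      indep_set {(\<lambda>\<omega>. W t \<omega> - W s \<omega>) -` A \<inter> space M | A. A \<in> sets borel}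
        (sets (brownian_filtration M W s))"

definition truncated_driver ::
  "(real ^ 'd \<Rightarrow> real \<Rightarrow> real ^ 'd \<Rightarrow> real) \<Rightarrow> real \<Rightarrow> real \<Rightarrow>
   real ^ 'd \<Rightarrow> real \<Rightarrow> real ^ 'd \<Rightarrow> real"
where
  "truncated_driver f \<rho> N x y z = f x y (closest_point (cball 0 (\<rho> * N)) z)"

definition is_grid :: "real \<Rightarrow> nat \<Rightarrow> (nat \<Rightarrow> real) \<Rightarrow> bool" where
  "is_grid T n t \<longleftrightarrow> t 0 = 0 \<and> t n = T \<and> (\<forall>i<n. t i < t (Suc i))"

definition step :: "(nat \<Rightarrow> real) \<Rightarrow> nat \<Rightarrow> real" where
  "step t i = t (Suc i) - t i"

definition mesh :: "nat \<Rightarrow> (nat \<Rightarrow> real) \<Rightarrow> real" where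
  "mesh n t = Max (step t ` {..<n})"

primrec euler_scheme ::
  "(real \<Rightarrow> 'a \<Rightarrow> real ^ 'd) \<Rightarrow> (real ^ 'd \<Rightarrow> real ^ 'd) \<Rightarrow> (real ^ 'd \<Rightarrow> real ^ 'd ^ 'd) \<Rightarrow>
   real ^ 'd \<Rightarrow> (nat \<Rightarrow> real) \<Rightarrow> nat \<Rightarrow> 'a \<Rightarrow> real ^ 'd"
where
  "euler_scheme W b \<sigma> x t 0 = (\<lambda>\<omega>. x)"
| "euler_scheme W b \<sigma> x t (Suc i) = (\<lambda>\<omega>.
     euler_scheme W b \<sigma> x t i \<omega>
     + step t i *\<^sub>R b (euler_scheme W b \<sigma> x t i \<omega>)
     + \<sigma> (euler_scheme W b \<sigma> x t i \<omega>) *v (W (t (Suc i)) \<omega> - W (t i) \<omega>))"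

definition weight ::
  "(real \<Rightarrow> 'a \<Rightarrow> real ^ 'd) \<Rightarrow> real \<Rightarrow> (nat \<Rightarrow> real) \<Rightarrow> nat \<Rightarrow> 'a \<Rightarrow> real ^ 'd"
where
  "weight W R t i \<omega> =
     (\<chi> l. max (- R / sqrt (step t i))
             (min ((W (t (Suc i)) \<omega> $ l - W (t i) \<omega> $ l) / step t i)
                  (R / sqrt (step t i))))"

text \<open>
  Solutions of the implicit backward scheme driven by \<open>F\<close>: adapted processes, integrable in the
  first component (so that all conditional expectations make sense), which satisfy the equations
  almost surely. Conditional expectations of vectors are taken componentwise.
\<close>

definition scheme_solution ::
  "'a measure \<Rightarrow> (real \<Rightarrow> 'a \<Rightarrow> real ^ 'd) \<Rightarrow> (real ^ 'd \<Rightarrow> real ^ 'd) \<Rightarrow>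
   (real ^ 'd \<Rightarrow> real ^ 'd ^ 'd) \<Rightarrow> (real ^ 'd \<Rightarrow> real) \<Rightarrow>
   (real ^ 'd \<Rightarrow> real \<Rightarrow> real ^ 'd \<Rightarrow> real) \<Rightarrow> real ^ 'd \<Rightarrow> real \<Rightarrow> nat \<Rightarrow> (nat \<Rightarrow> real) \<Rightarrow>
   (nat \<Rightarrow> 'a \<Rightarrow> real) \<Rightarrow> (nat \<Rightarrow> 'a \<Rightarrow> real ^ 'd) \<Rightarrow> bool"
where
  "scheme_solution M W b \<sigma> g F x R n t Y Z \<longleftrightarrow>
     (\<forall>i\<le>n. Y i \<in> borel_measurable (brownian_filtration M W (t i)) \<and>
            Z i \<in> borel_measurable (brownian_filtration M W (t i)) \<and>
            integrable M (Y i)) \<and>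
     (AE \<omega> in M. Y n \<omega> = g (euler_scheme W b \<sigma> x t n \<omega>) \<and> Z n \<omega> = 0) \<and>
     (\<forall>i<n. AE \<omega> in M.
        Y i \<omega> = real_cond_exp M (brownian_filtration M W (t i))
          (\<lambda>\<omega>'. Y (Suc i) \<omega>' + step t i * F (euler_scheme W b \<sigma> x t i \<omega>') (Y i \<omega>') (Z i \<omega>')) \<omega>) \<and>
     (\<forall>i<n. AE \<omega> in M.
        Z i \<omega> = (\<chi> l. real_cond_exp M (brownian_filtration M W (t i))
          (\<lambda>\<omega>'. Y (Suc i) \<omega>' * weight W R t i \<omega>' $ l) \<omega>))"

end

theory Submission
  imports Defs "HOL-Real_Asymp.Real_Asymp"
begin

text \<open>
  Because \<open>N R sqrt h\<close> tends to \<open>0\<close>, the weights \<open>1 + h \<gamma> \<bullet> H\<close> with \<open>\<bar>\<gamma>\<bar> \<le> N\<close> are nonnegative with conditional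
  mean \<open>1\<close>. Writing the dependence of the driver on \<open>Z\<close> through such a weight gives
  \<open>(1 - L h) (1 + \<bar>Y i\<bar>) \<le> 1 + sup \<bar>Y (i + 1)\<bar>\<close>, hence a uniform bound \<open>m\<close> for \<open>Y\<close>.

  For the \<open>Z\<close>-part one shows that \<open>exp (\<kappa> Y)\<close> with a large \<open>\<kappa>\<close> is a submartingale up to \<open>O(h)\<close> whose
  compensator dominates \<open>h \<bar>Z\<bar>\<^sup>2\<close>, and sums the increments. In continuous time this is Ito's formula; here
  the increments of \<open>Y\<close> are bounded but need not be small, so the rare large ones are treated separately.
\<close>

text \<open>Why the large increments need their own argument: on the whole range
  \<open>\<bar>D\<bar> \<le> 2 m\<close> of an increment \<open>D\<close> of \<open>Y\<close>, the
  available quadratic lower bound of \<open>exp (\<kappa> D)\<close> has a coefficient of order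
  \<open>\<kappa> / m\<close>, while the quadratic growth of the driver costs up to
  \<open>\<kappa> L d\<close> times the conditional variance. Both are linear in
  \<open>\<kappa>\<close>, so enlarging \<open>\<kappa>\<close> does not help unless
  \<open>m L d\<close> is small. Where \<open>\<bar>D\<bar> \<le> 2 / \<kappa>\<close>, the
  coefficient is \<open>\<kappa>^2 / 4\<close>, and \<open>\<kappa> = 8 L d\<close> makes the driver
  cost exactly half of it. For the remaining part \<open>J\<close> of \<open>D\<close>,
  \<open>\<bar>J\<bar> \<le> (\<kappa> / 2) J^2\<close>, so the bound \<open>B\<close> on the weight
  gives a part of \<open>Z\<close> that is linear in the conditional second moment of
  \<open>J\<close>. Multiplied by \<open>h N\<close> it carries the factor
  \<open>h N d B = d N R sqrt h\<close>, the same small quantity that makes the weights nonnegative.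
  This is why the driver is always estimated in mixed form: quadratic growth at a freely chosen
  \<open>z\<close>, plus \<open>N\<close> times the distance from \<open>Z\<close> to
  \<open>z\<close>.\<close>

section \<open>Quadratic lower bounds for the exponential\<close>

text \<open>The square of \<open>1 + x / 2 \<le> exp (x / 2)\<close>; the threshold
  \<open>- 2\<close> is where the left side stops being nonnegative.\<close>

lemma exp_ge_quadratic_near:
  fixes x :: real
  assumes "- 2 \<le> x"
  shows "1 + x + x\<^sup>2 / 4 \<le> exp x"
proof -
  have "1 + x / 2 \<le> exp (x / 2)"
    by (rule exp_ge_add_one_self)
  then have "(1 + x / 2)\<^sup>2 \<le> (exp (x / 2))\<^sup>2"
    using assms by (intro power_mono) auto
  also have "\<dots> = exp x"
    by (simp add: power2_eq_square flip: exp_add)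
  finally show ?thesis
    by (simp add: power2_eq_square algebra_simps)
qed

text \<open>Below \<open>- 2\<close> the quadratic term is at most \<open>\<bar>x\<bar> / 2\<close>,
  so the left side is not positive. A coefficient of order \<open>1 / \<beta>\<close> is the best
  possible, as \<open>x = - \<beta>\<close> shows.\<close>

lemma exp_ge_quadratic_bounded:
  fixes x \<beta> :: real
  assumes "\<bar>x\<bar> \<le> \<beta>" and "2 \<le> \<beta>"
  shows "1 + x + x\<^sup>2 / (2 * \<beta>) \<le> exp x"
proof (cases "- 2 \<le> x")
  case True
  have "x\<^sup>2 / (2 * \<beta>) \<le> x\<^sup>2 / 4"
    using assms by (intro divide_left_mono) auto
  with exp_ge_quadratic_near[OF True] show ?thesis by linarith
next
  case False
  have "x\<^sup>2 = \<bar>x\<bar> * \<bar>x\<bar>" by (simp add: power2_eq_square)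
  also have "\<dots> \<le> \<beta> * \<bar>x\<bar>" using assms by (intro mult_right_mono) auto
  finally have "x\<^sup>2 / (2 * \<beta>) \<le> \<bar>x\<bar> / 2" using assms by (simp add: field_simps)
  moreover have "0 < exp x" by simp
  ultimately show ?thesis using False by linarith
qed

section \<open>Essentially bounded variables and their conditional expectations\<close>

text \<open>Conditional expectations are only determined almost everywhere, so boundedness is too.
  The bound is hidden in an existential because it only serves to discharge integrability
  conditions; closure under arithmetic and conditioning then makes these conditions
  syntactic.\<close>

definition ess_bounded :: "'a measure \<Rightarrow> ('a \<Rightarrow> real) \<Rightarrow> bool" where
  "ess_bounded M f \<longleftrightarrow> f \<in> borel_measurable M \<and> (\<exists>c. AE \<omega> in M. \<bar>f \<omega>\<bar> \<le> c)"

lemma ess_boundedI: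
  assumes "f \<in> borel_measurable M" and "AE \<omega> in M. \<bar>f \<omega>\<bar> \<le> c"
  shows "ess_bounded M f"
  using assms unfolding ess_bounded_def by blast

lemma ess_bounded_measurable: "ess_bounded M f \<Longrightarrow> f \<in> borel_measurable M"
  unfolding ess_bounded_def by blast

lemma ess_bounded_const: "ess_bounded M (\<lambda>\<omega>. c)"
  by (rule ess_boundedI[where c = "\<bar>c\<bar>"]) auto

lemma ess_bounded_add:
  assumes "ess_bounded M f" and "ess_bounded M g"
  shows "ess_bounded M (\<lambda>\<omega>. f \<omega> + g \<omega>)"
proof -
  obtain a c where "AE \<omega> in M. \<bar>f \<omega>\<bar> \<le> a" and "AE \<omega> in M. \<bar>g \<omega>\<bar> \<le> c"
    using assms unfolding ess_bounded_def by blast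
  then have "AE \<omega> in M. \<bar>f \<omega> + g \<omega>\<bar> \<le> a + c" by eventually_elim linarith
  then show ?thesis
    using assms by (intro ess_boundedI) (auto simp: ess_bounded_def)
qed

lemma ess_bounded_mult:
  assumes "ess_bounded M f" and "ess_bounded M g"
  shows "ess_bounded M (\<lambda>\<omega>. f \<omega> * g \<omega>)"
proof -
  obtain a c where "AE \<omega> in M. \<bar>f \<omega>\<bar> \<le> a" and "AE \<omega> in M. \<bar>g \<omega>\<bar> \<le> c"
    using assms unfolding ess_bounded_def by blast
  then have "AE \<omega> in M. \<bar>f \<omega> * g \<omega>\<bar> \<le> a * c"
  proof eventually_elim
    case (elim \<omega>)
    then show ?case unfolding abs_mult by (intro mult_mono) auto
  qed
  then show ?thesis
    using assms by (intro ess_boundedI) (auto simp: ess_bounded_def)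
qed

lemma ess_bounded_diff:
  assumes "ess_bounded M f" and "ess_bounded M g"
  shows "ess_bounded M (\<lambda>\<omega>. f \<omega> - g \<omega>)"
  using ess_bounded_add[OF assms(1) ess_bounded_mult[OF ess_bounded_const[of M "-1"] assms(2)]]
  by simp

lemma ess_bounded_power2: "ess_bounded M f \<Longrightarrow> ess_bounded M (\<lambda>\<omega>. (f \<omega>)\<^sup>2)"
  using ess_bounded_mult[of M f f] by (simp add: power2_eq_square)

lemma ess_bounded_sum:
  assumes "\<And>i. i \<in> I \<Longrightarrow> ess_bounded M (f i)"
  shows "ess_bounded M (\<lambda>\<omega>. \<Sum>i\<in>I. f i \<omega>)"
  using assms
  by (induction I rule: infinite_finite_induct) (auto intro!: ess_bounded_add ess_bounded_const)

lemma ess_bounded_exp: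
  assumes "ess_bounded M f"
  shows "ess_bounded M (\<lambda>\<omega>. exp (f \<omega>))"
proof -
  obtain a where "AE \<omega> in M. \<bar>f \<omega>\<bar> \<le> a"
    using assms unfolding ess_bounded_def by blast
  then have "AE \<omega> in M. \<bar>exp (f \<omega>)\<bar> \<le> exp a" by eventually_elim simp
  then show ?thesis
    using assms by (intro ess_boundedI) (auto simp: ess_bounded_def)
qed

lemmas ess_bounded_intros =
  ess_bounded_const ess_bounded_add ess_bounded_diff ess_bounded_mult ess_bounded_power2
  ess_bounded_sum ess_bounded_exp

lemma (in finite_measure) ess_bounded_integrable:
  assumes "ess_bounded M f"
  shows "integrable M f"
  using assms integrable_const_bound[of f] unfolding ess_bounded_def by auto

lemma (in finite_measure_subalgebra) real_cond_exp_abs_le: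
  assumes "f \<in> borel_measurable M" and "AE \<omega> in M. \<bar>f \<omega>\<bar> \<le> c"
  shows "AE \<omega> in M. \<bar>real_cond_exp M F f \<omega>\<bar> \<le> c"
proof -
  have int: "integrable M f"
    using ess_bounded_integrable[OF ess_boundedI[OF assms]] .
  have "AE \<omega> in M. f \<omega> \<le> c" "AE \<omega> in M. - c \<le> f \<omega>"
    using assms(2) by (eventually_elim, linarith)+
  then have "AE \<omega> in M. real_cond_exp M F f \<omega> \<le> c" "AE \<omega> in M. - c \<le> real_cond_exp M F f \<omega>"
    using real_cond_exp_le_c[OF int] real_cond_exp_ge_c[OF int] by auto
  then show ?thesis by eventually_elim linarith
qed

lemma (in finite_measure_subalgebra) ess_bounded_cond_exp:
  "ess_bounded M f \<Longrightarrow> ess_bounded M (real_cond_exp M F f)"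
  using real_cond_exp_abs_le unfolding ess_bounded_def by fastforce

text \<open>Bridge from the signed calculus, where the estimates are made, to the extended
  nonnegative conditional expectation of the final claim. \<open>real_cond_exp\<close> is the
  difference of the \<open>enn2real\<close> values of the two parts, and the negative part vanishes
  here.\<close>

lemma (in finite_measure_subalgebra) nn_cond_exp_le_of_real_cond_exp_le:
  assumes "ess_bounded M f" and "AE \<omega> in M. 0 \<le> f \<omega>"
    and "AE \<omega> in M. real_cond_exp M F f \<omega> \<le> c"
  shows "AE \<omega> in M. nn_cond_exp M F (\<lambda>\<omega>. ennreal (f \<omega>)) \<omega> \<le> ennreal c"
proof -
  have [measurable]: "f \<in> borel_measurable M"
    using assms(1) by (rule ess_bounded_measurable)
  obtain a where a: "AE \<omega> in M. \<bar>f \<omega>\<bar> \<le> a"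
    using assms(1) unfolding ess_bounded_def by blast
  have "AE \<omega> in M. ennreal (f \<omega>) \<le> ennreal a"
    using a by eventually_elim (auto intro: ennreal_leI)
  then have "AE \<omega> in M. nn_cond_exp M F (\<lambda>\<omega>. ennreal (f \<omega>)) \<omega> \<le> nn_cond_exp M F (\<lambda>\<omega>. ennreal a) \<omega>"
    by (intro nn_cond_exp_mono) auto
  moreover have "AE \<omega> in M. ennreal a = nn_cond_exp M F (\<lambda>\<omega>. ennreal a) \<omega>"
    by (intro nn_cond_exp_F_meas) auto
  moreover have "AE \<omega> in M. nn_cond_exp M F (\<lambda>\<omega>. ennreal (- f \<omega>)) \<omega> = nn_cond_exp M F (\<lambda>\<omega>. 0) \<omega>"
    using assms(2) by (intro nn_cond_exp_cong) (auto elim: eventually_mono simp: ennreal_neg)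
  moreover have "AE \<omega> in M. 0 = nn_cond_exp M F (\<lambda>\<omega>. 0) \<omega>"
    by (intro nn_cond_exp_F_meas) auto
  ultimately show ?thesis
    using assms(3)
  proof eventually_elim
    case (elim \<omega>)
    \<comment> \<open>\<open>enn2real\<close> sends infinity to \<open>0\<close>, so a bound after
      \<open>enn2real\<close> is informative only once finiteness is known; the essential bound of
      \<open>f\<close> supplies it.\<close>
    have fin: "nn_cond_exp M F (\<lambda>\<omega>. ennreal (f \<omega>)) \<omega> < \<top>"
      using elim(1,2) by (metis ennreal_less_top order_le_less_trans)
    have "enn2real (nn_cond_exp M F (\<lambda>\<omega>. ennreal (f \<omega>)) \<omega>) \<le> c"
      using elim(3-5) by (simp add: real_cond_exp_def)
    then show ?case
      using fin by (metis ennreal_enn2real ennreal_leI)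
  qed
qed

section \<open>One step with an abstract weight\<close>

text \<open>What the one-step estimates use of the truncated Brownian weight, where \<open>B\<close>
  will be \<open>R / sqrt h\<close>. The second moment is only bounded by \<open>1 / h\<close>
  because truncation lowers it from that value.\<close>

locale conditional_weight = prob_space M + finite_measure_subalgebra M F
  for M F :: "'a measure" and H :: "'a \<Rightarrow> real ^ 'd" and h B :: real +
  assumes h_pos: "0 < h"
    and H_measurable: "\<And>l. (\<lambda>\<omega>. H \<omega> $ l) \<in> borel_measurable M"
    and H_bounded: "\<And>l \<omega>. \<bar>H \<omega> $ l\<bar> \<le> B"
    and cond_exp_H: "\<And>l. AE \<omega> in M. real_cond_exp M F (\<lambda>\<omega>. H \<omega> $ l) \<omega> = 0"
    and cond_exp_H_sq: "\<And>l. AE \<omega> in M. real_cond_exp M F (\<lambda>\<omega>. (H \<omega> $ l)\<^sup>2) \<omega> \<le> 1 / h"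
begin

lemma ess_bounded_H: "ess_bounded M (\<lambda>\<omega>. H \<omega> $ l)"
  by (rule ess_boundedI[OF H_measurable]) (use H_bounded in auto)

text \<open>The \<open>Z\<close> generated by \<open>A\<close>. If the components of
  \<open>H\<close> were conditionally orthogonal with second moment \<open>1 / h\<close>, then
  \<open>h\<close> times this vector would hold the coefficients of the conditional L2 projection of
  \<open>A\<close> onto them.\<close>

abbreviation proj :: "('a \<Rightarrow> real) \<Rightarrow> 'a \<Rightarrow> real ^ 'd" where
  "proj A \<omega> \<equiv> (\<chi> l. real_cond_exp M F (\<lambda>\<omega>'. A \<omega>' * H \<omega>' $ l) \<omega>)"

lemma cond_exp_mult_H_F_measurable:
  assumes "U \<in> borel_measurable F" and "ess_bounded M U"
  shows "AE \<omega> in M. real_cond_exp M F (\<lambda>\<omega>. U \<omega> * H \<omega> $ l) \<omega> = 0"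
proof -
  have "AE \<omega> in M. real_cond_exp M F (\<lambda>\<omega>. U \<omega> * H \<omega> $ l) \<omega> = U \<omega> * real_cond_exp M F (\<lambda>\<omega>. H \<omega> $ l) \<omega>"
    by (intro real_cond_exp_mult assms H_measurable ess_bounded_integrable ess_bounded_intros ess_bounded_H)
  with cond_exp_H[of l] show ?thesis by eventually_elim simp
qed

lemma proj_add:
  assumes "ess_bounded M A" and "ess_bounded M A'"
  shows "AE \<omega> in M. proj (\<lambda>\<omega>. A \<omega> + A' \<omega>) \<omega> = proj A \<omega> + proj A' \<omega>"
proof -
  have "AE \<omega> in M. real_cond_exp M F (\<lambda>\<omega>. A \<omega> * H \<omega> $ l + A' \<omega> * H \<omega> $ l) \<omega>
      = real_cond_exp M F (\<lambda>\<omega>. A \<omega> * H \<omega> $ l) \<omega> + real_cond_exp M F (\<lambda>\<omega>. A' \<omega> * H \<omega> $ l) \<omega>" for l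
    by (intro real_cond_exp_add ess_bounded_integrable ess_bounded_intros assms ess_bounded_H)
  then have "AE \<omega> in M. \<forall>l. real_cond_exp M F (\<lambda>\<omega>. A \<omega> * H \<omega> $ l + A' \<omega> * H \<omega> $ l) \<omega>
      = real_cond_exp M F (\<lambda>\<omega>. A \<omega> * H \<omega> $ l) \<omega> + real_cond_exp M F (\<lambda>\<omega>. A' \<omega> * H \<omega> $ l) \<omega>"
    by (simp add: AE_all_countable)
  then show ?thesis by eventually_elim (simp add: vec_eq_iff distrib_right)
qed

lemma cond_exp_inner_H:
  assumes A: "ess_bounded M A"
    and u: "\<And>l. (\<lambda>\<omega>. u \<omega> $ l) \<in> borel_measurable F" "\<And>l. ess_bounded M (\<lambda>\<omega>. u \<omega> $ l)"
  shows "AE \<omega> in M. real_cond_exp M F (\<lambda>\<omega>. A \<omega> * (u \<omega> \<bullet> H \<omega>)) \<omega> = u \<omega> \<bullet> proj A \<omega>"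
proof -
  have "AE \<omega> in M. real_cond_exp M F (\<lambda>\<omega>. u \<omega> $ l * (A \<omega> * H \<omega> $ l)) \<omega>
      = u \<omega> $ l * real_cond_exp M F (\<lambda>\<omega>. A \<omega> * H \<omega> $ l) \<omega>" for l
    by (intro real_cond_exp_mult ess_bounded_integrable ess_bounded_measurable ess_bounded_intros u A ess_bounded_H)
  then have "AE \<omega> in M. \<forall>l. real_cond_exp M F (\<lambda>\<omega>. u \<omega> $ l * (A \<omega> * H \<omega> $ l)) \<omega>
      = u \<omega> $ l * real_cond_exp M F (\<lambda>\<omega>. A \<omega> * H \<omega> $ l) \<omega>"
    by (simp add: AE_all_countable)
  moreover have "AE \<omega> in M. real_cond_exp M F (\<lambda>\<omega>. \<Sum>l\<in>UNIV. u \<omega> $ l * (A \<omega> * H \<omega> $ l)) \<omega>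
      = (\<Sum>l\<in>UNIV. real_cond_exp M F (\<lambda>\<omega>. u \<omega> $ l * (A \<omega> * H \<omega> $ l)) \<omega>)"
    by (intro real_cond_exp_sum ess_bounded_integrable ess_bounded_intros u A ess_bounded_H)
  ultimately show ?thesis
    by eventually_elim (simp add: inner_vec_def sum_distrib_left mult.left_commute)
qed

text \<open>
  For \<open>c * CARD('d) * B \<le> 1\<close> the factors \<open>1 \<plusminus> c u \<bullet> H\<close> with \<open>\<bar>u\<bar> \<le> 1\<close> are nonnegative with conditional
  mean \<open>1\<close>; the choice \<open>u = sgn Z\<close> is the worst case.
\<close>

lemma cond_exp_plus_norm_proj_le:
  assumes Y: "Y \<in> borel_measurable M" "AE \<omega> in M. \<bar>Y \<omega>\<bar> \<le> m"
    and c: "0 \<le> c" "c * (CARD('d) * B) \<le> 1"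
  shows "AE \<omega> in M. \<bar>real_cond_exp M F Y \<omega>\<bar> + c * norm (proj Y \<omega>) \<le> m"
proof -
  have bY: "ess_bounded M Y" by (rule ess_boundedI[OF Y])
  define u where "u \<omega> = sgn (proj Y \<omega>)" for \<omega>
  have uF: "(\<lambda>\<omega>. u \<omega> $ l) \<in> borel_measurable F" for l
    unfolding u_def sgn_div_norm norm_vec_def L2_set_def by simp
  have nu: "norm (u \<omega>) \<le> 1" for \<omega>
    unfolding u_def by (simp add: norm_sgn)
  have uM: "ess_bounded M (\<lambda>\<omega>. u \<omega> $ l)" for l
    using measurable_from_subalg[OF subalg uF] order_trans[OF component_le_norm_cart nu]
    by (intro ess_boundedI[where c = 1]) auto
  have nH: "norm (H \<omega>) \<le> CARD('d) * B" for \<omega>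
    by (rule order_trans[OF norm_le_l1_cart]) (intro sum_bounded_above H_bounded)
  have cuH: "\<bar>c * (u \<omega> \<bullet> H \<omega>)\<bar> \<le> 1" for \<omega>
  proof -
    have "\<bar>u \<omega> \<bullet> H \<omega>\<bar> \<le> 1 * (CARD('d) * B)"
      by (rule order_trans[OF Cauchy_Schwarz_ineq2]) (intro mult_mono nu nH, auto)
    then have "c * \<bar>u \<omega> \<bullet> H \<omega>\<bar> \<le> c * (CARD('d) * B)"
      using c(1) by (intro mult_left_mono) auto
    then show ?thesis using c by (simp add: abs_mult)
  qed
  have uH: "ess_bounded M (\<lambda>\<omega>. u \<omega> \<bullet> H \<omega>)"
    unfolding inner_vec_def inner_real_def by (intro ess_bounded_intros uM ess_bounded_H)
  have E_uH: "AE \<omega> in M. real_cond_exp M F (\<lambda>\<omega>. u \<omega> \<bullet> H \<omega>) \<omega> = 0"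
  proof -
    have "AE \<omega> in M. \<forall>l. real_cond_exp M F (\<lambda>\<omega>. H \<omega> $ l) \<omega> = 0"
      using cond_exp_H by (simp add: AE_all_countable)
    with cond_exp_inner_H[of "\<lambda>_. 1", OF ess_bounded_const uF uM] show ?thesis
      by eventually_elim (simp add: inner_vec_def)
  qed
  \<comment> \<open>The two signs \<open>s\<close> together yield the absolute value. With
    \<open>v = c (u \<bullet> H)\<close> one has \<open>\<bar>s + v\<bar> = 1 + s v\<close> since
    \<open>\<bar>v\<bar> \<le> 1\<close>, so the upper bound \<open>m (1 + s v)\<close> has
    conditional mean \<open>m\<close>, while \<open>Y (s + v)\<close> produces \<open>c\<close>
    times the norm of \<open>Z\<close>.\<close>
  have "AE \<omega> in M. s * real_cond_exp M F Y \<omega> + c * norm (proj Y \<omega>) \<le> m" if s: "\<bar>s\<bar> = 1" for s :: real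
  proof -
    have "AE \<omega> in M. s * Y \<omega> + c * (Y \<omega> * (u \<omega> \<bullet> H \<omega>)) \<le> m + (m * s * c) * (u \<omega> \<bullet> H \<omega>)"
      using Y(2)
    proof eventually_elim
      case (elim \<omega>)
      define v where "v = c * (u \<omega> \<bullet> H \<omega>)"
      have "\<bar>s + v\<bar> = 1 + s * v"
        using s cuH[of \<omega>] unfolding v_def[symmetric]
        by (cases "s = 1"; cases "s = - 1") auto
      moreover have "Y \<omega> * (s + v) \<le> \<bar>Y \<omega>\<bar> * \<bar>s + v\<bar>"
        by (rule order_trans[OF abs_ge_self]) (simp add: abs_mult)
      moreover have "\<bar>Y \<omega>\<bar> * \<bar>s + v\<bar> \<le> m * \<bar>s + v\<bar>"
        using elim by (intro mult_right_mono) auto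
      ultimately have "Y \<omega> * (s + v) \<le> m * (1 + s * v)"
        by simp
      then show ?case unfolding v_def by (simp add: algebra_simps)
    qed
    then have "AE \<omega> in M. real_cond_exp M F (\<lambda>\<omega>. s * Y \<omega> + c * (Y \<omega> * (u \<omega> \<bullet> H \<omega>))) \<omega>
        \<le> real_cond_exp M F (\<lambda>\<omega>. m + (m * s * c) * (u \<omega> \<bullet> H \<omega>)) \<omega>"
      by (intro real_cond_exp_mono ess_bounded_integrable ess_bounded_intros bY uH)
    moreover have "AE \<omega> in M. real_cond_exp M F (\<lambda>\<omega>. s * Y \<omega> + c * (Y \<omega> * (u \<omega> \<bullet> H \<omega>))) \<omega>
        = real_cond_exp M F (\<lambda>\<omega>. s * Y \<omega>) \<omega> + real_cond_exp M F (\<lambda>\<omega>. c * (Y \<omega> * (u \<omega> \<bullet> H \<omega>))) \<omega>"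
      by (intro real_cond_exp_add ess_bounded_integrable ess_bounded_intros bY uH)
    moreover have "AE \<omega> in M. real_cond_exp M F (\<lambda>\<omega>. s * Y \<omega>) \<omega> = s * real_cond_exp M F Y \<omega>"
      by (intro real_cond_exp_cmult ess_bounded_integrable bY)
    moreover have "AE \<omega> in M. real_cond_exp M F (\<lambda>\<omega>. c * (Y \<omega> * (u \<omega> \<bullet> H \<omega>))) \<omega>
        = c * real_cond_exp M F (\<lambda>\<omega>. Y \<omega> * (u \<omega> \<bullet> H \<omega>)) \<omega>"
      by (intro real_cond_exp_cmult ess_bounded_integrable ess_bounded_intros bY uH)
    moreover have "AE \<omega> in M. real_cond_exp M F (\<lambda>\<omega>. m + (m * s * c) * (u \<omega> \<bullet> H \<omega>)) \<omega>
        = real_cond_exp M F (\<lambda>\<omega>. m) \<omega> + real_cond_exp M F (\<lambda>\<omega>. (m * s * c) * (u \<omega> \<bullet> H \<omega>)) \<omega>"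
      by (intro real_cond_exp_add ess_bounded_integrable ess_bounded_intros uH)
    moreover have "AE \<omega> in M. real_cond_exp M F (\<lambda>\<omega>. m) \<omega> = m"
      by (intro real_cond_exp_F_meas) auto
    moreover have "AE \<omega> in M. real_cond_exp M F (\<lambda>\<omega>. (m * s * c) * (u \<omega> \<bullet> H \<omega>)) \<omega>
        = (m * s * c) * real_cond_exp M F (\<lambda>\<omega>. u \<omega> \<bullet> H \<omega>) \<omega>"
      by (intro real_cond_exp_cmult ess_bounded_integrable uH)
    moreover note E_uH cond_exp_inner_H[OF bY uF uM]
    ultimately show ?thesis
    proof eventually_elim
      case (elim \<omega>)
      have "u \<omega> \<bullet> proj Y \<omega> = norm (proj Y \<omega>)"
        unfolding u_def sgn_div_norm
        by (cases "proj Y \<omega> = 0") (simp_all add: dot_square_norm power2_eq_square)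
      with elim show ?case by simp
    qed
  qed
  from this[of 1, simplified] this[of "-1", simplified] show ?thesis
    by eventually_elim linarith
qed

text \<open>Conditional Cauchy-Schwarz inequality in each component; adding the components gives the
  factor \<open>CARD('d)\<close>.\<close>

lemma norm_proj_sq_le:
  assumes A: "ess_bounded M A"
  shows "AE \<omega> in M. h * (norm (proj A \<omega>))\<^sup>2 \<le> CARD('d) * real_cond_exp M F (\<lambda>\<omega>. (A \<omega>)\<^sup>2) \<omega>"
proof -
  have "AE \<omega> in M. h * (proj A \<omega> $ l)\<^sup>2 \<le> real_cond_exp M F (\<lambda>\<omega>. (A \<omega>)\<^sup>2) \<omega>" for l
  proof -
    define z where "z = real_cond_exp M F (\<lambda>\<omega>. A \<omega> * H \<omega> $ l)"
    have zF[measurable]: "z \<in> borel_measurable F" unfolding z_def by simp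
    have AH: "ess_bounded M (\<lambda>\<omega>. A \<omega> * H \<omega> $ l)"
      by (intro ess_bounded_intros A ess_bounded_H)
    have zb: "ess_bounded M z" unfolding z_def by (intro ess_bounded_cond_exp AH)
    \<comment> \<open>Expanded square of \<open>A - h z H\<close>. The coefficient
      \<open>h z\<close> is the optimal one: conditioning gives \<open>2 h z^2\<close> on the left
      and at most \<open>h z^2\<close> besides the second moment of \<open>A\<close> on the
      right.\<close>
    have "AE \<omega> in M. 2 * h * z \<omega> * (A \<omega> * H \<omega> $ l) \<le> (A \<omega>)\<^sup>2 + (h * z \<omega>)\<^sup>2 * (H \<omega> $ l)\<^sup>2"
    proof (rule AE_I2)
      fix \<omega>
      have "0 \<le> (A \<omega> - h * z \<omega> * H \<omega> $ l)\<^sup>2" by simp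
      then show "2 * h * z \<omega> * (A \<omega> * H \<omega> $ l) \<le> (A \<omega>)\<^sup>2 + (h * z \<omega>)\<^sup>2 * (H \<omega> $ l)\<^sup>2"
        by (simp add: power2_eq_square algebra_simps)
    qed
    then have "AE \<omega> in M. real_cond_exp M F (\<lambda>\<omega>. 2 * h * z \<omega> * (A \<omega> * H \<omega> $ l)) \<omega>
        \<le> real_cond_exp M F (\<lambda>\<omega>. (A \<omega>)\<^sup>2 + (h * z \<omega>)\<^sup>2 * (H \<omega> $ l)\<^sup>2) \<omega>"
      by (intro real_cond_exp_mono ess_bounded_integrable ess_bounded_intros A AH zb ess_bounded_H)
    moreover have "AE \<omega> in M. real_cond_exp M F (\<lambda>\<omega>. 2 * h * z \<omega> * (A \<omega> * H \<omega> $ l)) \<omega>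
        = 2 * h * z \<omega> * z \<omega>"
      unfolding z_def[symmetric]
      using real_cond_exp_mult[of "\<lambda>\<omega>. 2 * h * z \<omega>" "\<lambda>\<omega>. A \<omega> * H \<omega> $ l"]
      by (simp add: z_def[symmetric] ess_bounded_integrable ess_bounded_measurable AH zb ess_bounded_intros)
    moreover have "AE \<omega> in M. real_cond_exp M F (\<lambda>\<omega>. (A \<omega>)\<^sup>2 + (h * z \<omega>)\<^sup>2 * (H \<omega> $ l)\<^sup>2) \<omega>
        = real_cond_exp M F (\<lambda>\<omega>. (A \<omega>)\<^sup>2) \<omega> + real_cond_exp M F (\<lambda>\<omega>. (h * z \<omega>)\<^sup>2 * (H \<omega> $ l)\<^sup>2) \<omega>"
      by (intro real_cond_exp_add ess_bounded_integrable ess_bounded_intros A zb ess_bounded_H)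
    moreover have "AE \<omega> in M. real_cond_exp M F (\<lambda>\<omega>. (h * z \<omega>)\<^sup>2 * (H \<omega> $ l)\<^sup>2) \<omega>
        = (h * z \<omega>)\<^sup>2 * real_cond_exp M F (\<lambda>\<omega>. (H \<omega> $ l)\<^sup>2) \<omega>"
      using real_cond_exp_mult[of "\<lambda>\<omega>. (h * z \<omega>)\<^sup>2" "\<lambda>\<omega>. (H \<omega> $ l)\<^sup>2"]
      by (simp add: ess_bounded_integrable ess_bounded_measurable zb ess_bounded_H ess_bounded_intros)
    ultimately show ?thesis
      using cond_exp_H_sq[of l]
    proof eventually_elim
      case (elim \<omega>)
      have "(h * z \<omega>)\<^sup>2 * real_cond_exp M F (\<lambda>\<omega>. (H \<omega> $ l)\<^sup>2) \<omega> \<le> (h * z \<omega>)\<^sup>2 * (1 / h)"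
        using elim(5) by (intro mult_left_mono) auto
      also have "\<dots> = h * (z \<omega>)\<^sup>2"
        using h_pos by (simp add: power2_eq_square)
      finally show ?case
        using elim(1-4) by (simp add: z_def[symmetric] power2_eq_square)
    qed
  qed
  then have "AE \<omega> in M. \<forall>l. h * (proj A \<omega> $ l)\<^sup>2 \<le> real_cond_exp M F (\<lambda>\<omega>. (A \<omega>)\<^sup>2) \<omega>"
    by (simp add: AE_all_countable)
  then show ?thesis
  proof eventually_elim
    case (elim \<omega>)
    have "h * (norm (proj A \<omega>))\<^sup>2 = (\<Sum>l\<in>UNIV. h * (proj A \<omega> $ l)\<^sup>2)"
      unfolding norm_vec_def L2_set_def by (simp add: sum_nonneg sum_distrib_left)
    also have "\<dots> \<le> CARD('d) * real_cond_exp M F (\<lambda>\<omega>. (A \<omega>)\<^sup>2) \<omega>"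
      using sum_bounded_above[of UNIV "\<lambda>l. h * (proj A \<omega> $ l)\<^sup>2"] elim by auto
    finally show ?case .
  qed
qed


text \<open>
  The increment \<open>D = Y' - Y\<close> is split at the level \<open>2 / \<kappa>\<close>. Below it, \<open>exp (\<kappa> D)\<close> has a quadratic lower
  bound with a universal constant, which absorbs the quadratic growth of the driver in the part of
  \<open>Z\<close> generated by small increments; above it the constant degenerates, but there the driver only
  contributes through its Lipschitz constant \<open>N\<close> with a factor \<open>h * N * B\<close>, which is small.
\<close>

lemma exp_submartingale_step:
  fixes Y Y' G :: "'a \<Rightarrow> real" and Z :: "'a \<Rightarrow> real ^ 'd" and L N m \<kappa> \<beta> :: real
  defines "d \<equiv> real CARD('d)"
  assumes Y': "Y' \<in> borel_measurable M" "AE \<omega> in M. \<bar>Y' \<omega>\<bar> \<le> m"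
    and Y: "Y \<in> borel_measurable F" "AE \<omega> in M. \<bar>Y \<omega>\<bar> \<le> m"
    and Z: "AE \<omega> in M. Z \<omega> = proj Y' \<omega>"
    and YG: "AE \<omega> in M. Y \<omega> = real_cond_exp M F Y' \<omega> + h * G \<omega>"
    and G: "AE \<omega> in M. \<forall>z. \<bar>G \<omega>\<bar> \<le> L * (1 + m + (norm z)\<^sup>2) + N * norm (Z \<omega> - z)"
    and L: "0 < L" and N: "0 \<le> N" and m: "0 \<le> m"
    and \<kappa>: "\<kappa> = 8 * L * d" and \<beta>: "\<beta> = 2 + 2 * \<kappa> * m"
    and small: "2 * \<beta> * (h * N * (d * B)) \<le> 1"
  shows "AE \<omega> in M. h * (norm (Z \<omega>))\<^sup>2 \<le> 4 * \<beta> * d * exp (\<kappa> * m) / \<kappa>\<^sup>2 *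
      (real_cond_exp M F (\<lambda>\<omega>. exp (\<kappa> * Y' \<omega>)) \<omega> - exp (\<kappa> * Y \<omega>) + exp (\<kappa> * m) * \<kappa> * L * (1 + m) * h)"
proof -
  have d: "0 < d" unfolding d_def by simp
  have \<kappa>_pos: "0 < \<kappa>" using L d unfolding \<kappa> by simp
  have \<beta>_ge: "2 \<le> \<beta>" using m \<kappa>_pos unfolding \<beta> by simp
  have YM [measurable]: "Y \<in> borel_measurable M" by (rule measurable_from_subalg[OF subalg Y(1)])
  note [measurable] = Y'(1) Y(1)
  have bY': "ess_bounded M Y'" and bY: "ess_bounded M Y"
    by (rule ess_boundedI[OF Y'], rule ess_boundedI[OF YM Y(2)])
  define D where "D \<omega> = Y' \<omega> - Y \<omega>" for \<omega>
  define A where "A \<omega> = (if \<bar>D \<omega>\<bar> \<le> 2 / \<kappa> then D \<omega> else 0)" for \<omega>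
  define J where "J \<omega> = (if \<bar>D \<omega>\<bar> \<le> 2 / \<kappa> then 0 else D \<omega>)" for \<omega>
  have [measurable]: "D \<in> borel_measurable M" "A \<in> borel_measurable M" "J \<in> borel_measurable M"
    unfolding D_def A_def J_def by measurable
  have Dm: "AE \<omega> in M. \<bar>D \<omega>\<bar> \<le> 2 * m"
    using Y'(2) Y(2) unfolding D_def by eventually_elim linarith
  have bD: "ess_bounded M D" by (rule ess_boundedI[OF _ Dm]) simp
  have bA: "ess_bounded M A"
    by (rule ess_boundedI[where c = "2 / \<kappa>"]) (use \<kappa>_pos in \<open>auto simp: A_def\<close>)
  have "AE \<omega> in M. \<bar>J \<omega>\<bar> \<le> 2 * m"
    using Dm by eventually_elim (use m in \<open>auto simp: J_def\<close>)
  then have bJ: "ess_bounded M J" by (intro ess_boundedI) simp_all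
  define VA where "VA = real_cond_exp M F (\<lambda>\<omega>. (A \<omega>)\<^sup>2)"
  define VJ where "VJ = real_cond_exp M F (\<lambda>\<omega>. (J \<omega>)\<^sup>2)"
  have VA_pos: "AE \<omega> in M. 0 \<le> VA \<omega>" and VJ_pos: "AE \<omega> in M. 0 \<le> VJ \<omega>"
    unfolding VA_def VJ_def by (intro real_cond_exp_pos; simp)+

  \<comment> \<open>\<open>Y\<close> is \<open>F\<close>-measurable and the weight is conditionally
    centred, so \<open>Z\<close> only sees the increment. This is what allows it to be split along
    \<open>A\<close> and \<open>J\<close>.\<close>
  have Z_D: "AE \<omega> in M. Z \<omega> = proj D \<omega>"
  proof -
    have "AE \<omega> in M. proj (\<lambda>\<omega>. D \<omega> + Y \<omega>) \<omega> = proj D \<omega> + proj Y \<omega>"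
      by (rule proj_add[OF bD bY])
    moreover have "AE \<omega> in M. \<forall>l. proj Y \<omega> $ l = 0"
      using cond_exp_mult_H_F_measurable[OF Y(1) bY] by (simp add: AE_all_countable)
    ultimately show ?thesis
      using Z by eventually_elim (simp add: D_def vec_eq_iff)
  qed
  have D_AJ: "D \<omega> = A \<omega> + J \<omega>" for \<omega> unfolding A_def J_def by simp
  have Z_AJ: "AE \<omega> in M. Z \<omega> = proj A \<omega> + proj J \<omega>"
    using Z_D proj_add[OF bA bJ] unfolding D_AJ[symmetric] by eventually_elim simp
  have D_sq: "(D \<omega>)\<^sup>2 = (A \<omega>)\<^sup>2 + (J \<omega>)\<^sup>2" for \<omega> unfolding A_def J_def by simp
  have V_D: "AE \<omega> in M. real_cond_exp M F (\<lambda>\<omega>. (D \<omega>)\<^sup>2) \<omega> = VA \<omega> + VJ \<omega>"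
    unfolding VA_def VJ_def D_sq
    by (intro real_cond_exp_add ess_bounded_integrable ess_bounded_intros bA bJ)

  \<comment> \<open>Linear in \<open>VJ\<close>, unlike the square root that Cauchy-Schwarz would
    give: where \<open>J\<close> is nonzero it exceeds \<open>2 / \<kappa>\<close> in absolute
    value, so its first moment is controlled by its second.\<close>
  have proj_J: "AE \<omega> in M. norm (proj J \<omega>) \<le> d * (B * \<kappa> / 2 * VJ \<omega>)"
  proof -
    have "AE \<omega> in M. \<bar>proj J \<omega> $ l\<bar> \<le> B * \<kappa> / 2 * VJ \<omega>" for l
    proof -
      have JH: "\<bar>J \<omega> * H \<omega> $ l\<bar> \<le> B * \<kappa> / 2 * (J \<omega>)\<^sup>2" for \<omega>
      proof -
        have "\<bar>J \<omega>\<bar> \<le> \<kappa> / 2 * (J \<omega>)\<^sup>2"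
        proof (cases "J \<omega> = 0")
          case False
          then have "1 \<le> \<kappa> / 2 * \<bar>J \<omega>\<bar>"
            using \<kappa>_pos by (auto simp: J_def field_simps split: if_splits)
          then have "1 * \<bar>J \<omega>\<bar> \<le> \<kappa> / 2 * \<bar>J \<omega>\<bar> * \<bar>J \<omega>\<bar>" by (intro mult_right_mono) auto
          then show ?thesis by (simp add: power2_eq_square mult.assoc)
        qed simp
        then have "\<bar>J \<omega>\<bar> * \<bar>H \<omega> $ l\<bar> \<le> (\<kappa> / 2 * (J \<omega>)\<^sup>2) * B"
          by (intro mult_mono H_bounded) auto
        then show ?thesis by (simp add: abs_mult mult_ac)
      qed
      have JHb: "ess_bounded M (\<lambda>\<omega>. J \<omega> * H \<omega> $ l)"
        by (intro ess_bounded_intros bJ ess_bounded_H)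
      have V: "AE \<omega> in M. real_cond_exp M F (\<lambda>\<omega>. c * (J \<omega>)\<^sup>2) \<omega> = c * VJ \<omega>" for c
        unfolding VJ_def by (intro real_cond_exp_cmult ess_bounded_integrable ess_bounded_intros bJ)
      have "AE \<omega> in M. real_cond_exp M F (\<lambda>\<omega>. J \<omega> * H \<omega> $ l) \<omega> \<le> real_cond_exp M F (\<lambda>\<omega>. B * \<kappa> / 2 * (J \<omega>)\<^sup>2) \<omega>"
        by (intro real_cond_exp_mono AE_I2 ess_bounded_integrable ess_bounded_intros bJ ess_bounded_H)
          (rule abs_le_D1[OF JH])
      moreover have "AE \<omega> in M. real_cond_exp M F (\<lambda>\<omega>. (- (B * \<kappa> / 2)) * (J \<omega>)\<^sup>2) \<omega> \<le> real_cond_exp M F (\<lambda>\<omega>. J \<omega> * H \<omega> $ l) \<omega>"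
        by (intro real_cond_exp_mono AE_I2 ess_bounded_integrable ess_bounded_intros bJ ess_bounded_H)
          (use abs_le_D2[OF JH] in \<open>simp add: minus_le_iff\<close>)
      ultimately show ?thesis
        using V[of "B * \<kappa> / 2"] V[of "- (B * \<kappa> / 2)"] by eventually_elim simp
    qed
    then have "AE \<omega> in M. \<forall>l. \<bar>proj J \<omega> $ l\<bar> \<le> B * \<kappa> / 2 * VJ \<omega>"
      by (simp add: AE_all_countable)
    then show ?thesis
    proof eventually_elim
      case (elim \<omega>)
      have "norm (proj J \<omega>) \<le> (\<Sum>l\<in>UNIV. \<bar>proj J \<omega> $ l\<bar>)" by (rule norm_le_l1_cart)
      also have "\<dots> \<le> d * (B * \<kappa> / 2 * VJ \<omega>)"
        unfolding d_def using elim by (intro sum_bounded_above) auto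
      finally show ?case .
    qed
  qed

  have E_D: "AE \<omega> in M. real_cond_exp M F D \<omega> = - (h * G \<omega>)"
  proof -
    have "AE \<omega> in M. real_cond_exp M F D \<omega> = real_cond_exp M F Y' \<omega> - real_cond_exp M F Y \<omega>"
      unfolding D_def by (intro real_cond_exp_diff ess_bounded_integrable bY' bY)
    moreover have "AE \<omega> in M. real_cond_exp M F Y \<omega> = Y \<omega>"
      by (intro real_cond_exp_F_meas ess_bounded_integrable bY Y(1))
    ultimately show ?thesis using YG by eventually_elim simp
  qed

  \<comment> \<open>Minorant of \<open>exp (\<kappa> D)\<close>, with the coefficient of the near
    bound on \<open>A\<close> and that of the bounded one on \<open>J\<close>. The term
    \<open>2 \<kappa> m\<close> of \<open>\<beta>\<close> covers
    \<open>\<bar>\<kappa> D\<bar>\<close>, and the summand \<open>2\<close> ensures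
    \<open>\<beta> \<ge> 2\<close>.\<close>
  define Q where "Q \<omega> = 1 + (\<kappa> * D \<omega> + (\<kappa>\<^sup>2 / 4 * (A \<omega>)\<^sup>2 + \<kappa>\<^sup>2 / (2 * \<beta>) * (J \<omega>)\<^sup>2))" for \<omega>
  have bQ: "ess_bounded M Q" unfolding Q_def by (intro ess_bounded_intros bD bA bJ)
  have "AE \<omega> in M. exp (\<kappa> * Y \<omega>) * Q \<omega> \<le> exp (\<kappa> * Y' \<omega>)"
    using Dm
  proof eventually_elim
    case (elim \<omega>)
    have "Q \<omega> \<le> exp (\<kappa> * D \<omega>)"
    proof (cases "\<bar>D \<omega>\<bar> \<le> 2 / \<kappa>")
      case True
      then have "- 2 \<le> \<kappa> * D \<omega>" using \<kappa>_pos by (simp add: field_simps abs_le_iff)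
      from exp_ge_quadratic_near[OF this] show ?thesis
        using True by (simp add: Q_def A_def J_def power_mult_distrib)
    next
      case False
      have "\<kappa> * \<bar>D \<omega>\<bar> \<le> \<kappa> * (2 * m)" using elim \<kappa>_pos by (intro mult_left_mono) auto
      moreover have "\<bar>\<kappa> * D \<omega>\<bar> = \<kappa> * \<bar>D \<omega>\<bar>" using \<kappa>_pos by (simp add: abs_mult)
      ultimately have "\<bar>\<kappa> * D \<omega>\<bar> \<le> \<beta>" unfolding \<beta> by linarith
      from exp_ge_quadratic_bounded[OF this \<beta>_ge] show ?thesis
        using False by (simp add: Q_def A_def J_def power_mult_distrib)
    qed
    then have "exp (\<kappa> * Y \<omega>) * Q \<omega> \<le> exp (\<kappa> * Y \<omega>) * exp (\<kappa> * D \<omega>)" by simp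
    also have "\<dots> = exp (\<kappa> * Y' \<omega>)" by (simp add: D_def algebra_simps flip: exp_add)
    finally show ?case .
  qed
  then have "AE \<omega> in M. real_cond_exp M F (\<lambda>\<omega>. exp (\<kappa> * Y \<omega>) * Q \<omega>) \<omega> \<le> real_cond_exp M F (\<lambda>\<omega>. exp (\<kappa> * Y' \<omega>)) \<omega>"
    by (intro real_cond_exp_mono ess_bounded_integrable ess_bounded_intros bY bY' bQ)
  moreover have "AE \<omega> in M. real_cond_exp M F (\<lambda>\<omega>. exp (\<kappa> * Y \<omega>) * Q \<omega>) \<omega> = exp (\<kappa> * Y \<omega>) * real_cond_exp M F Q \<omega>"
    by (intro real_cond_exp_mult ess_bounded_integrable ess_bounded_intros bY bQ ess_bounded_measurable[OF bQ]) simp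
  moreover have "AE \<omega> in M. real_cond_exp M F Q \<omega>
      = 1 + (\<kappa> * real_cond_exp M F D \<omega> + (\<kappa>\<^sup>2 / 4 * VA \<omega> + \<kappa>\<^sup>2 / (2 * \<beta>) * VJ \<omega>))"
  proof -
    have "AE \<omega> in M. real_cond_exp M F Q \<omega> = real_cond_exp M F (\<lambda>\<omega>. 1) \<omega>
        + real_cond_exp M F (\<lambda>\<omega>. \<kappa> * D \<omega> + (\<kappa>\<^sup>2 / 4 * (A \<omega>)\<^sup>2 + \<kappa>\<^sup>2 / (2 * \<beta>) * (J \<omega>)\<^sup>2)) \<omega>"
      unfolding Q_def by (intro real_cond_exp_add ess_bounded_integrable ess_bounded_intros bD bA bJ)
    moreover have "AE \<omega> in M. real_cond_exp M F (\<lambda>\<omega>. 1) \<omega> = (1::real)"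
      by (intro real_cond_exp_F_meas) auto
    moreover have "AE \<omega> in M. real_cond_exp M F (\<lambda>\<omega>. \<kappa> * D \<omega> + (\<kappa>\<^sup>2 / 4 * (A \<omega>)\<^sup>2 + \<kappa>\<^sup>2 / (2 * \<beta>) * (J \<omega>)\<^sup>2)) \<omega>
        = real_cond_exp M F (\<lambda>\<omega>. \<kappa> * D \<omega>) \<omega> + real_cond_exp M F (\<lambda>\<omega>. \<kappa>\<^sup>2 / 4 * (A \<omega>)\<^sup>2 + \<kappa>\<^sup>2 / (2 * \<beta>) * (J \<omega>)\<^sup>2) \<omega>"
      by (intro real_cond_exp_add ess_bounded_integrable ess_bounded_intros bD bA bJ)
    moreover have "AE \<omega> in M. real_cond_exp M F (\<lambda>\<omega>. \<kappa>\<^sup>2 / 4 * (A \<omega>)\<^sup>2 + \<kappa>\<^sup>2 / (2 * \<beta>) * (J \<omega>)\<^sup>2) \<omega>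
        = real_cond_exp M F (\<lambda>\<omega>. \<kappa>\<^sup>2 / 4 * (A \<omega>)\<^sup>2) \<omega> + real_cond_exp M F (\<lambda>\<omega>. \<kappa>\<^sup>2 / (2 * \<beta>) * (J \<omega>)\<^sup>2) \<omega>"
      by (intro real_cond_exp_add ess_bounded_integrable ess_bounded_intros bD bA bJ)
    moreover have "AE \<omega> in M. real_cond_exp M F (\<lambda>\<omega>. \<kappa> * D \<omega>) \<omega> = \<kappa> * real_cond_exp M F D \<omega>"
      by (intro real_cond_exp_cmult ess_bounded_integrable bD)
    moreover have "AE \<omega> in M. real_cond_exp M F (\<lambda>\<omega>. \<kappa>\<^sup>2 / 4 * (A \<omega>)\<^sup>2) \<omega> = \<kappa>\<^sup>2 / 4 * VA \<omega>"
      unfolding VA_def by (intro real_cond_exp_cmult ess_bounded_integrable ess_bounded_intros bA)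
    moreover have "AE \<omega> in M. real_cond_exp M F (\<lambda>\<omega>. \<kappa>\<^sup>2 / (2 * \<beta>) * (J \<omega>)\<^sup>2) \<omega> = \<kappa>\<^sup>2 / (2 * \<beta>) * VJ \<omega>"
      unfolding VJ_def by (intro real_cond_exp_cmult ess_bounded_integrable ess_bounded_intros bJ)
    ultimately show ?thesis by eventually_elim simp
  qed
  moreover note E_D G Z_AJ Z_D V_D proj_J VA_pos VJ_pos Y(2) norm_proj_sq_le[OF bA] norm_proj_sq_le[OF bD]
  ultimately show ?thesis
  proof eventually_elim
    case (elim \<omega>)
    define p E where "p = exp (\<kappa> * Y \<omega>)" and "E = real_cond_exp M F (\<lambda>\<omega>. exp (\<kappa> * Y' \<omega>)) \<omega>"
    have nn: "0 \<le> VA \<omega>" "0 \<le> VJ \<omega>" by fact+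
    have A_bd: "h * (norm (proj A \<omega>))\<^sup>2 \<le> d * VA \<omega>"
      using elim(13) unfolding VA_def d_def .
    have Z_bd: "h * (norm (Z \<omega>))\<^sup>2 \<le> d * (VA \<omega> + VJ \<omega>)"
      using elim(14) unfolding elim(7)[symmetric] elim(8) d_def .
    \<comment> \<open>The free \<open>z\<close> in the hypothesis on \<open>G\<close> is taken to be
      the small-increment part of \<open>Z\<close>: quadratic growth is paid only there, and the
      constant \<open>N\<close> only on the large-increment part.\<close>
    have "h * \<bar>G \<omega>\<bar> \<le> h * (L * (1 + m + (norm (proj A \<omega>))\<^sup>2) + N * norm (Z \<omega> - proj A \<omega>))"
      using elim(5) h_pos by (intro mult_left_mono) auto
    also have "\<dots> = L * (1 + m) * h + L * (h * (norm (proj A \<omega>))\<^sup>2) + h * N * norm (proj J \<omega>)"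
      using elim(6) by (simp add: algebra_simps)
    also have "\<dots> \<le> L * (1 + m) * h + L * (d * VA \<omega>) + h * N * (d * (B * \<kappa> / 2 * VJ \<omega>))"
      using A_bd elim(9) L N h_pos m by (intro add_mono mult_left_mono) auto
    also have "\<dots> = L * (1 + m) * h + L * d * VA \<omega> + h * N * (d * B) * (\<kappa> / 2) * VJ \<omega>"
      by simp
    finally have "h * G \<omega> \<le> L * (1 + m) * h + L * d * VA \<omega> + h * N * (d * B) * (\<kappa> / 2) * VJ \<omega>"
      using mult_left_mono[OF abs_ge_self[of "G \<omega>"] less_imp_le[OF h_pos]] by linarith
    then have "\<kappa> * (h * G \<omega>) \<le> \<kappa> * (L * (1 + m) * h + L * d * VA \<omega> + h * N * (d * B) * (\<kappa> / 2) * VJ \<omega>)"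
      using \<kappa>_pos by (intro mult_left_mono) auto
    \<comment> \<open>Here \<open>\<kappa> = 8 L d\<close> turns \<open>\<kappa> L d\<close> into
      \<open>\<kappa>^2 / 8\<close>, half of the coefficient of \<open>VA\<close> in
      \<open>Q\<close>.\<close>
    also have "\<dots> = \<kappa> * L * (1 + m) * h + \<kappa>\<^sup>2 / 8 * VA \<omega> + (h * N * (d * B)) * (\<kappa>\<^sup>2 / 2 * VJ \<omega>)"
      unfolding \<kappa> by (simp add: power2_eq_square algebra_simps)
    \<comment> \<open>Likewise \<open>small\<close> limits the cost of the large increments to half
      of their coefficient \<open>\<kappa>^2 / (2 \<beta>)\<close>.\<close>
    also have "\<dots> \<le> \<kappa> * L * (1 + m) * h + \<kappa>\<^sup>2 / 8 * VA \<omega> + 1 / (2 * \<beta>) * (\<kappa>\<^sup>2 / 2 * VJ \<omega>)"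
    proof -
      have "h * N * (d * B) \<le> 1 / (2 * \<beta>)"
        using small \<beta>_ge by (simp add: field_simps)
      then show ?thesis
        using nn by (intro add_left_mono mult_right_mono) auto
    qed
    finally have lG: "\<kappa> * (h * G \<omega>) \<le> \<kappa> * L * (1 + m) * h + \<kappa>\<^sup>2 / 8 * VA \<omega> + \<kappa>\<^sup>2 / (4 * \<beta>) * VJ \<omega>"
      by simp
    \<comment> \<open>The remaining halves are \<open>\<kappa>^2 / 8\<close> on \<open>VA\<close>
      and \<open>\<kappa>^2 / (4 \<beta>)\<close> on \<open>VJ\<close>; as
      \<open>\<beta> \<ge> 2\<close>, the second serves for both and multiplies the full variance of
      \<open>D\<close>, which dominates \<open>h\<close> times the squared norm of
      \<open>Z\<close>.\<close>
    have "\<kappa>\<^sup>2 / (4 * \<beta>) * VA \<omega> \<le> \<kappa>\<^sup>2 / 8 * VA \<omega>"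
      using nn \<beta>_ge by (intro mult_right_mono divide_left_mono) auto
    moreover have "\<kappa>\<^sup>2 / (2 * \<beta>) * VJ \<omega> = 2 * (\<kappa>\<^sup>2 / (4 * \<beta>) * VJ \<omega>)"
      by simp
    ultimately have Q_bd: "1 + \<kappa>\<^sup>2 / (4 * \<beta>) * (VA \<omega> + VJ \<omega>) - \<kappa> * L * (1 + m) * h
        \<le> 1 + (\<kappa> * real_cond_exp M F D \<omega> + (\<kappa>\<^sup>2 / 4 * VA \<omega> + \<kappa>\<^sup>2 / (2 * \<beta>) * VJ \<omega>))"
      using lG unfolding elim(4) distrib_left mult_minus_right by linarith
    have "p * (1 + \<kappa>\<^sup>2 / (4 * \<beta>) * (VA \<omega> + VJ \<omega>) - \<kappa> * L * (1 + m) * h) \<le> p * real_cond_exp M F Q \<omega>"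
      unfolding elim(3) by (rule mult_left_mono[OF Q_bd]) (simp add: p_def)
    also have "\<dots> \<le> E"
      using elim(1,2) unfolding p_def E_def by linarith
    finally have pE: "p * (\<kappa>\<^sup>2 / (4 * \<beta>) * (VA \<omega> + VJ \<omega>)) \<le> E - p + p * (\<kappa> * L * (1 + m) * h)"
      by (simp add: algebra_simps)
    have "\<kappa> * Y \<omega> \<le> \<kappa> * m" "\<kappa> * (- m) \<le> \<kappa> * Y \<omega>"
      by (rule mult_left_mono; use \<open>\<bar>Y \<omega>\<bar> \<le> m\<close> \<kappa>_pos in linarith)+
    then have p_le: "p \<le> exp (\<kappa> * m)" and p_ge: "exp (- (\<kappa> * m)) \<le> p"
      unfolding p_def exp_le_cancel_iff by linarith+
    have "exp (- (\<kappa> * m)) * (\<kappa>\<^sup>2 / (4 * \<beta>) * (VA \<omega> + VJ \<omega>)) \<le> p * (\<kappa>\<^sup>2 / (4 * \<beta>) * (VA \<omega> + VJ \<omega>))"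
      using p_ge nn \<beta>_ge by (intro mult_right_mono) auto
    also have "\<dots> \<le> E - p + exp (\<kappa> * m) * (\<kappa> * L * (1 + m) * h)"
    proof -
      have "p * (\<kappa> * L * (1 + m) * h) \<le> exp (\<kappa> * m) * (\<kappa> * L * (1 + m) * h)"
        using p_le \<kappa>_pos L m h_pos by (intro mult_right_mono) auto
      with pE show ?thesis by linarith
    qed
    finally have "exp (- (\<kappa> * m)) * (\<kappa>\<^sup>2 / (4 * \<beta>) * (VA \<omega> + VJ \<omega>)) \<le> E - p + exp (\<kappa> * m) * \<kappa> * L * (1 + m) * h"
      by (simp add: mult.assoc)
    \<comment> \<open>The prefactor inverts the lower bound
      \<open>exp (- \<kappa> m) \<kappa>^2 / (4 \<beta>)\<close> of the compensator and adds the
      dimension factor from \<open>norm_proj_sq_le\<close>.\<close>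
    then have "4 * \<beta> * d * exp (\<kappa> * m) / \<kappa>\<^sup>2 * (exp (- (\<kappa> * m)) * (\<kappa>\<^sup>2 / (4 * \<beta>) * (VA \<omega> + VJ \<omega>)))
        \<le> 4 * \<beta> * d * exp (\<kappa> * m) / \<kappa>\<^sup>2 * (E - p + exp (\<kappa> * m) * \<kappa> * L * (1 + m) * h)"
      using \<beta>_ge d by (intro mult_left_mono) auto
    moreover have "4 * \<beta> * d * exp (\<kappa> * m) / \<kappa>\<^sup>2 * (exp (- (\<kappa> * m)) * (\<kappa>\<^sup>2 / (4 * \<beta>) * (VA \<omega> + VJ \<omega>))) = d * (VA \<omega> + VJ \<omega>)"
      using \<beta>_ge \<kappa>_pos by (simp add: exp_minus field_simps)
    ultimately show ?case using Z_bd unfolding E_def p_def by linarith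
  qed
qed

end

section \<open>Brownian weights\<close>

lemma borel_measurable_component [measurable (raw)]:
  fixes f :: "'a \<Rightarrow> real ^ 'd"
  assumes "f \<in> borel_measurable M"
  shows "(\<lambda>\<omega>. f \<omega> $ l) \<in> borel_measurable M"
  by (rule measurable_compose[OF assms borel_measurable_continuous_onI]) (intro continuous_intros)

text \<open>Tonelli over the coordinates: every marginal other than the \<open>k\<close>-th
  integrates to \<open>1\<close>.\<close>

lemma nn_integral_product_density_component:
  fixes p :: "real \<Rightarrow> real" and u :: "real \<Rightarrow> ennreal"
  assumes p: "p \<in> borel_measurable borel" "\<And>x. 0 \<le> p x" "(\<integral>\<^sup>+x. ennreal (p x) \<partial>lborel) = 1"
    and u [measurable]: "u \<in> borel_measurable borel"
  shows "(\<integral>\<^sup>+x. ennreal (\<Prod>l\<in>UNIV. p (x $ l)) * u (x $ k) \<partial>(lborel :: (real ^ 'd) measure))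
    = (\<integral>\<^sup>+y. ennreal (p y) * u y \<partial>lborel)"
proof -
  note [measurable] = p(1)
  \<comment> \<open>Attaching \<open>u\<close> to the single basis vector of coordinate
    \<open>k\<close> turns the integrand into a product over \<open>Basis\<close>.\<close>
  define f where "f b y = ennreal (p y) * (if b = axis k (1::real) then u y else 1)" for b :: "real ^ 'd" and y
  have inj: "inj (\<lambda>l::'d. axis l (1::real))"
    by (auto intro!: injI simp: axis_eq_axis)
  have Basis: "Basis = range (\<lambda>l::'d. axis l (1::real))"
    by (auto simp: Basis_vec_def)
  have prod_Basis: "(\<Prod>b\<in>Basis. v b) = (\<Prod>l\<in>UNIV. v (axis l 1))" for v :: "real ^ 'd \<Rightarrow> ennreal"
    unfolding Basis using inj by (simp add: prod.reindex)
  have [simp]: "(axis l (1::real) = axis k 1) = (l = k)" for l :: 'd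
    by (simp add: axis_eq_axis)
  have "(\<integral>\<^sup>+x. ennreal (\<Prod>l\<in>UNIV. p (x $ l)) * u (x $ k) \<partial>(lborel :: (real ^ 'd) measure))
      = (\<integral>\<^sup>+x. (\<Prod>b\<in>Basis. f b (x \<bullet> b)) \<partial>lborel)"
    unfolding prod_Basis f_def
    by (intro nn_integral_cong)
      (simp add: inner_axis prod.distrib prod.delta prod_ennreal p(2))
  also have "\<dots> = (\<Prod>b\<in>Basis. (\<integral>\<^sup>+y. f b y \<partial>lborel))"
    by (rule nn_integral_lborel_prod) (auto simp: f_def)
  also have "\<dots> = (\<Prod>l\<in>UNIV. if l = k then (\<integral>\<^sup>+y. ennreal (p y) * u y \<partial>lborel) else 1)"
    unfolding prod_Basis f_def by (intro prod.cong refl) (simp add: p(3))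
  finally show ?thesis by (simp add: prod.delta)
qed

text \<open>Tested against the indicator of a set of \<open>F\<close>, independence factors the
  integral. The family of preimages in the hypothesis is already a sigma-algebra, so it can be
  compared directly with the one generated by \<open>g (X)\<close>.\<close>

lemma (in prob_space) real_cond_exp_indep:
  fixes g :: "'b \<Rightarrow> real"
  assumes sub: "subalgebra M F" and X: "random_variable N X" and g: "g \<in> borel_measurable N"
    and int: "integrable M (\<lambda>\<omega>. g (X \<omega>))"
    and indep: "indep_set {X -` A \<inter> space M | A. A \<in> sets N} (sets F)"
  shows "AE \<omega> in M. real_cond_exp M F (\<lambda>\<omega>. g (X \<omega>)) \<omega> = expectation (\<lambda>\<omega>. g (X \<omega>))"
proof -
  interpret F: finite_measure_subalgebra M F
    by unfold_locales (rule sub)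
  have sF: "space F = space M" "sets F \<subseteq> events" using sub by (auto simp: subalgebra_def)
  show ?thesis
  proof (rule F.real_cond_exp_charact)
    fix A assume A: "A \<in> sets F"
    have [measurable]: "A \<in> events" using A sF by auto
    have "sigma_sets (space M) {(\<lambda>\<omega>. g (X \<omega>)) -` C \<inter> space M | C. C \<in> sets (borel :: real measure)}
        \<subseteq> sets (vimage_algebra (space M) X N)"
    proof -
      have "(\<lambda>\<omega>. g (X \<omega>)) \<in> borel_measurable (vimage_algebra (space M) X N)"
        by (rule measurable_compose[OF measurable_vimage_algebra1 g]) (use measurable_space[OF X] in blast)
      from measurable_sets[OF this]
      have "{(\<lambda>\<omega>. g (X \<omega>)) -` C \<inter> space M | C. C \<in> sets (borel :: real measure)}
          \<subseteq> sets (vimage_algebra (space M) X N)"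
        by (simp add: subset_iff) blast
      from sets.sigma_sets_subset[OF this] show ?thesis by simp
    qed
    also have "\<dots> = {X -` A \<inter> space M | A. A \<in> sets N}"
      by (rule sets_vimage_algebra2) (use measurable_space[OF X] in blast)
    finally have 1: "sigma_sets (space M) {(\<lambda>\<omega>. g (X \<omega>)) -` C \<inter> space M | C. C \<in> sets (borel :: real measure)}
        \<subseteq> {X -` A \<inter> space M | A. A \<in> sets N}" .
    have "{indicator A -` C \<inter> space M | C. C \<in> sets (borel :: real measure)} \<subseteq> sets F"
    proof -
      have "(indicator A :: 'a \<Rightarrow> real) \<in> borel_measurable F" using A by simp
      from measurable_sets[OF this] show ?thesis by (simp add: sF subset_iff) blast
    qed
    from sets.sigma_sets_subset[OF this]
    have 2: "sigma_sets (space M) {indicator A -` C \<inter> space M | C. C \<in> sets (borel :: real measure)} \<subseteq> sets F"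
      by (simp add: sF)
    have "indep_var borel (\<lambda>\<omega>. g (X \<omega>)) borel (indicator A :: 'a \<Rightarrow> real)"
      unfolding indep_var_eq
    proof (intro conjI)
      show "random_variable borel (\<lambda>\<omega>. g (X \<omega>))" using X g by simp
      show "indep_set (sigma_sets (space M) {(\<lambda>\<omega>. g (X \<omega>)) -` C \<inter> space M | C. C \<in> sets (borel :: real measure)})
          (sigma_sets (space M) {indicator A -` C \<inter> space M | C. C \<in> sets (borel :: real measure)})"
        unfolding indep_set_def
        by (rule indep_sets_mono_sets[OF indep[unfolded indep_set_def]])
          (simp split: bool.split add: 1 2)
    qed simp
    moreover have "integrable M (indicator A :: 'a \<Rightarrow> real)"
      by (rule integrable_real_indicator) (auto simp: less_top[symmetric])
    ultimately have "expectation (\<lambda>\<omega>. g (X \<omega>) * indicator A \<omega>) = expectation (\<lambda>\<omega>. g (X \<omega>)) * prob A"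
      by (subst indep_var_lebesgue_integral[OF _ int]) simp_all
    then show "(\<integral>\<omega>\<in>A. g (X \<omega>) \<partial>M) = (\<integral>\<omega>\<in>A. expectation (\<lambda>\<omega>. g (X \<omega>)) \<partial>M)"
      by (simp add: set_lebesgue_integral_def mult.commute)
  qed (use int in auto)
qed

lemma lborel_integral_odd_eq_0:
  fixes f :: "real \<Rightarrow> real"
  assumes "\<And>x. f (- x) = - f x"
  shows "(\<integral>x. f x \<partial>lborel) = 0"
  using lborel_integral_real_affine[of "-1" f 0] assms by simp

lemma space_brownian_filtration: "space (brownian_filtration M W t) = space M"
  unfolding brownian_filtration_def by (rule space_measure_of_conv)

context brownian_motion
begin

lemma generator_brownian_filtration:
  assumes "t \<le> T"
  shows "{W s -` A \<inter> space M | s A. s \<in> {0..t} \<and> A \<in> sets borel} \<union> null_sets M \<subseteq> events"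
proof (intro Un_least subsetI)
  fix S assume "S \<in> {W s -` A \<inter> space M | s A. s \<in> {0..t} \<and> A \<in> sets borel}"
  then obtain s A where "S = W s -` A \<inter> space M" "s \<in> {0..t}" "A \<in> sets borel" by blast
  with assms show "S \<in> events"
    by (simp add: measurable_sets[OF random_variable_W])
qed (rule null_setsD2)

lemma sets_brownian_filtration:
  assumes "t \<le> T"
  shows "sets (brownian_filtration M W t) = sigma_sets (space M)
    ({W s -` A \<inter> space M | s A. s \<in> {0..t} \<and> A \<in> sets borel} \<union> null_sets M)"
  unfolding brownian_filtration_def
  by (rule sets_measure_of, rule order_trans[OF generator_brownian_filtration[OF assms] sets.space_closed])

lemma subalgebra_brownian_filtration:
  assumes "t \<le> T"
  shows "subalgebra M (brownian_filtration M W t)"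
  unfolding subalgebra_def space_brownian_filtration sets_brownian_filtration[OF assms]
  by (intro conjI refl sets.sigma_sets_subset generator_brownian_filtration[OF assms])

lemma subalgebra_brownian_filtration_mono:
  assumes "s \<le> t" and "t \<le> T"
  shows "subalgebra (brownian_filtration M W t) (brownian_filtration M W s)"
proof -
  have "s \<le> T" using assms by simp
  show ?thesis
    unfolding subalgebra_def space_brownian_filtration sets_brownian_filtration[OF assms(2)]
      sets_brownian_filtration[OF \<open>s \<le> T\<close>]
  proof (intro conjI refl sigma_sets_mono' Un_mono)
    show "{W r -` A \<inter> space M | r A. r \<in> {0..s} \<and> A \<in> sets borel}
        \<subseteq> {W r -` A \<inter> space M | r A. r \<in> {0..t} \<and> A \<in> sets borel}"
      by (intro Collect_mono, clarify, intro exI conjI, rule refl) (use assms(1) in auto)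
  qed simp
qed

lemma measurable_W_brownian_filtration:
  assumes "0 \<le> s" "s \<le> t" "t \<le> T"
  shows "W s \<in> borel_measurable (brownian_filtration M W t)"
proof (rule measurableI)
  fix A :: "(real ^ 'd) set" assume "A \<in> sets borel"
  then show "W s -` A \<inter> space (brownian_filtration M W t) \<in> sets (brownian_filtration M W t)"
    unfolding space_brownian_filtration sets_brownian_filtration[OF assms(3)]
    using assms by (intro sigma_sets.Basic UnI1) auto
qed simp

text \<open>Passes from the joint Gaussian density to its marginals, which suffice because each
  component of the weight depends on one coordinate of the increment.\<close>

lemma distributed_increment_component:
  assumes "0 \<le> s" "s < t" "t \<le> T"
  shows "distributed M lborel (\<lambda>\<omega>. W t \<omega> $ l - W s \<omega> $ l) (normal_density 0 (sqrt (t - s)))"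
proof -
  let ?p = "normal_density 0 (sqrt (t - s))"
  note D = gaussian_increments[OF assms]
  have [measurable]: "W t \<in> borel_measurable M" "W s \<in> borel_measurable M"
    using assms by (auto intro: random_variable_W)
  have p1: "(\<integral>\<^sup>+x. ennreal (?p x) \<partial>lborel) = 1"
    using assms by (subst nn_integral_eq_integral) (auto simp: integral_normal_density)
  have "distr M lborel (\<lambda>\<omega>. W t \<omega> $ l - W s \<omega> $ l) = density lborel ?p"
  proof (rule measure_eqI)
    fix A assume "A \<in> sets (distr M lborel (\<lambda>\<omega>. W t \<omega> $ l - W s \<omega> $ l))"
    then have [measurable]: "A \<in> sets borel" by simp
    have "emeasure (distr M lborel (\<lambda>\<omega>. W t \<omega> $ l - W s \<omega> $ l)) A
        = (\<integral>\<^sup>+\<omega>. indicator A ((W t \<omega> - W s \<omega>) $ l) \<partial>M)"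
      by (subst nn_integral_indicator[symmetric], simp, subst nn_integral_distr) auto
    also have "\<dots> = (\<integral>\<^sup>+x. ennreal (\<Prod>l\<in>UNIV. ?p (x $ l)) * indicator A (x $ l) \<partial>lborel)"
      by (subst distributed_nn_integral[OF D, symmetric]) auto
    also have "\<dots> = (\<integral>\<^sup>+x. ennreal (?p x) * indicator A x \<partial>lborel)"
      by (rule nn_integral_product_density_component) (auto simp: p1)
    also have "\<dots> = emeasure (density lborel ?p) A"
      by (simp add: emeasure_density)
    finally show "emeasure (distr M lborel (\<lambda>\<omega>. W t \<omega> $ l - W s \<omega> $ l)) A = emeasure (density lborel ?p) A" .
  qed simp
  moreover have "(\<lambda>\<omega>. W t \<omega> $ l - W s \<omega> $ l) \<in> borel_measurable M" by measurable
  ultimately show ?thesis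
    unfolding distributed_def by simp
qed

text \<open>Each component is an odd truncation \<open>\<phi>\<close> of a centred Gaussian
  increment that is independent of the past. Oddness gives mean zero, and truncation moves values
  towards \<open>0\<close>, so the second moment is at most \<open>h / h^2\<close>. The sign of
  \<open>R\<close> matters: for \<open>R < 0\<close> the max-min expression is a positive
  constant.\<close>

lemma conditional_weight_weight:
  assumes "0 \<le> \<tau> i" "\<tau> i < \<tau> (Suc i)" "\<tau> (Suc i) \<le> T" "0 \<le> R"
  shows "conditional_weight M (brownian_filtration M W (\<tau> i)) (weight W R \<tau> i) (step \<tau> i) (R / sqrt (step \<tau> i))"
proof -
  let ?F = "brownian_filtration M W (\<tau> i)"
  define h where "h = step \<tau> i"
  define B where "B = R / sqrt h"
  have h: "0 < h" "h = \<tau> (Suc i) - \<tau> i" using assms by (auto simp: h_def step_def)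
  have B: "0 \<le> B" using h assms unfolding B_def by simp
  define \<phi> where "\<phi> y = max (- B) (min (y / h) B)" for y
  have [measurable]: "\<phi> \<in> borel_measurable borel" unfolding \<phi>_def by measurable
  have \<phi>_odd: "\<phi> (- y) = - \<phi> y" for y unfolding \<phi>_def using B by (auto simp: max_def min_def)
  have \<phi>_bd: "\<bar>\<phi> y\<bar> \<le> B" for y unfolding \<phi>_def using B by auto
  have \<phi>_sq: "(\<phi> y)\<^sup>2 \<le> (y / h)\<^sup>2" for y
  proof -
    have "\<bar>max (- B) (min q B)\<bar> \<le> \<bar>q\<bar>" for q using B by (auto simp: max_def min_def)
    then have "\<bar>\<phi> y\<bar> \<le> \<bar>y / h\<bar>" unfolding \<phi>_def .
    then show ?thesis by (rule abs_le_square_iff[THEN iffD1])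
  qed
  define X where "X l \<omega> = W (\<tau> (Suc i)) \<omega> $ l - W (\<tau> i) \<omega> $ l" for l \<omega>
  have w: "weight W R \<tau> i \<omega> $ l = \<phi> (X l \<omega>)" for \<omega> l
    unfolding weight_def \<phi>_def B_def X_def h_def[symmetric] by simp
  have [measurable]: "W (\<tau> i) \<in> borel_measurable M" "W (\<tau> (Suc i)) \<in> borel_measurable M"
    using assms by (auto intro: random_variable_W)
  have XM [measurable]: "X l \<in> borel_measurable M" for l unfolding X_def by measurable
  have sub: "subalgebra M ?F" using assms by (intro subalgebra_brownian_filtration) simp
  interpret F: finite_measure_subalgebra M ?F by unfold_locales (rule sub)
  have indep: "AE \<omega> in M. real_cond_exp M ?F (\<lambda>\<omega>. u (X l \<omega>)) \<omega> = expectation (\<lambda>\<omega>. u (X l \<omega>))"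
    if [measurable]: "u \<in> borel_measurable borel" and bd: "\<And>y. \<bar>u y\<bar> \<le> c" for u :: "real \<Rightarrow> real" and c l
  proof -
    have "AE \<omega> in M. real_cond_exp M ?F (\<lambda>\<omega>. u ((W (\<tau> (Suc i)) \<omega> - W (\<tau> i) \<omega>) $ l)) \<omega>
        = expectation (\<lambda>\<omega>. u ((W (\<tau> (Suc i)) \<omega> - W (\<tau> i) \<omega>) $ l))"
      by (rule real_cond_exp_indep[where g = "\<lambda>x. u (x $ l)", OF sub _ _ _ independent_increments])
        (use assms bd in \<open>auto intro: integrable_const_bound[where B = c]\<close>)
    then show ?thesis by (simp add: X_def)
  qed
  have D: "distributed M lborel (X l) (normal_density 0 (sqrt h))" for l
    unfolding X_def h(2) using assms by (intro distributed_increment_component)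
  have mean: "expectation (\<lambda>\<omega>. \<phi> (X l \<omega>)) = 0" for l
    unfolding distributed_integral[OF D, of \<phi>, simplified, symmetric]
    by (rule lborel_integral_odd_eq_0) (simp add: \<phi>_odd normal_density_def)
  have var: "expectation (\<lambda>\<omega>. (\<phi> (X l \<omega>))\<^sup>2) \<le> 1 / h" for l
  proof -
    have m2: "has_bochner_integral lborel (\<lambda>y. normal_density 0 (sqrt h) y * y\<^sup>2) h"
      using normal_moment_even[of "sqrt h" 0 1] h(1) by (simp add: fact_numeral)
    have "expectation (\<lambda>\<omega>. (\<phi> (X l \<omega>))\<^sup>2) = (\<integral>y. normal_density 0 (sqrt h) y * (\<phi> y)\<^sup>2 \<partial>lborel)"
      by (rule distributed_integral[OF D, symmetric]) auto
    also have "\<dots> \<le> (\<integral>y. (normal_density 0 (sqrt h) y * y\<^sup>2) * (1 / h\<^sup>2) \<partial>lborel)"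
    proof (rule integral_mono')
      show "integrable lborel (\<lambda>y. normal_density 0 (sqrt h) y * y\<^sup>2 * (1 / h\<^sup>2))"
        using m2 by (intro integrable_mult_left) (simp add: has_bochner_integral_iff)
      show "normal_density 0 (sqrt h) y * (\<phi> y)\<^sup>2 \<le> normal_density 0 (sqrt h) y * y\<^sup>2 * (1 / h\<^sup>2)" for y
        using mult_left_mono[OF \<phi>_sq normal_density_nonneg] by (simp add: power_divide)
    qed simp
    also have "\<dots> = 1 / h"
      using m2 h by (simp add: has_bochner_integral_iff power2_eq_square)
    finally show ?thesis .
  qed
  show ?thesis
    unfolding h_def[symmetric] B_def[symmetric]
  proof unfold_locales
    show "0 < h" by fact
    show "(\<lambda>\<omega>. weight W R \<tau> i \<omega> $ l) \<in> borel_measurable M" for l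
      unfolding w by measurable
    show "\<bar>weight W R \<tau> i \<omega> $ l\<bar> \<le> B" for l \<omega>
      unfolding w by (rule \<phi>_bd)
    show "AE \<omega> in M. real_cond_exp M ?F (\<lambda>\<omega>. weight W R \<tau> i \<omega> $ l) \<omega> = 0" for l
      using indep[of \<phi> B l] \<phi>_bd unfolding w mean by simp
    have \<phi>_sq_bd: "\<bar>(\<phi> y)\<^sup>2\<bar> \<le> B\<^sup>2" for y
      using \<phi>_bd[of y] B by (simp add: abs_le_square_iff[symmetric])
    show "AE \<omega> in M. real_cond_exp M ?F (\<lambda>\<omega>. (weight W R \<tau> i \<omega> $ l)\<^sup>2) \<omega> \<le> 1 / h" for l
      unfolding w using indep[of "\<lambda>y. (\<phi> y)\<^sup>2", OF _ \<phi>_sq_bd, of l, simplified]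
      by eventually_elim (simp add: var)
  qed
qed

end

section \<open>Uniform bound for the scheme\<close>

lemma lipschitz_on_borel_measurable:
  fixes f :: "'a::metric_space \<Rightarrow> 'b::metric_space"
  assumes "K-lipschitz_on UNIV f"
  shows "f \<in> borel_measurable borel"
  using lipschitz_on_continuous_on[OF assms] by (rule borel_measurable_continuous_onI)

lemma borel_measurable_vec_componentI:
  fixes f :: "'a \<Rightarrow> real ^ 'd"
  assumes "\<And>l. (\<lambda>\<omega>. f \<omega> $ l) \<in> borel_measurable M"
  shows "f \<in> borel_measurable M"
proof (rule borel_measurable_euclidean_space[THEN iffD2, rule_format])
  fix b :: "real ^ 'd" assume "b \<in> Basis"
  then obtain l where "b = axis l 1" by (auto simp: Basis_vec_def)
  then show "(\<lambda>\<omega>. f \<omega> \<bullet> b) \<in> borel_measurable M"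
    using assms by (simp add: inner_axis)
qed

lemma borel_measurable_matrix_vector_mult:
  fixes A :: "'a \<Rightarrow> real ^ 'd ^ 'd" and v :: "'a \<Rightarrow> real ^ 'd"
  assumes A: "A \<in> borel_measurable M" and [measurable]: "v \<in> borel_measurable M"
  shows "(\<lambda>\<omega>. A \<omega> *v v \<omega>) \<in> borel_measurable M"
proof (rule borel_measurable_vec_componentI)
  have "(\<lambda>\<omega>. A \<omega> $ l) \<in> borel_measurable M" for l
    by (rule measurable_compose[OF A borel_measurable_continuous_onI]) (intro continuous_intros)
  then show "(\<lambda>\<omega>. (A \<omega> *v v \<omega>) $ l) \<in> borel_measurable M" for l
    unfolding matrix_vector_mult_def by simp
qed

lemma grid_mono:
  assumes "is_grid T n \<tau>" and "i \<le> j" and "j \<le> n"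
  shows "\<tau> i \<le> \<tau> j"
  using assms(2,3)
proof (induction rule: dec_induct)
  case (step k)
  then have "\<tau> i \<le> \<tau> k" by simp
  also have "\<tau> k < \<tau> (Suc k)"
    using assms(1) step.prems by (simp add: is_grid_def)
  finally show ?case by simp
qed simp

context brownian_motion
begin

lemma measurable_euler_scheme:
  assumes b: "b \<in> borel_measurable borel" and \<sigma>: "\<sigma> \<in> borel_measurable borel"
    and grid: "is_grid T n \<tau>" and "i \<le> n"
  shows "euler_scheme W b \<sigma> x \<tau> i \<in> borel_measurable (brownian_filtration M W (\<tau> i))"
  using \<open>i \<le> n\<close>
proof (induction i)
  case (Suc i)
  let ?F = "brownian_filtration M W (\<tau> (Suc i))"
  have \<tau>: "0 \<le> \<tau> i" "\<tau> i \<le> \<tau> (Suc i)" "\<tau> (Suc i) \<le> T"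
    using grid_mono[OF grid, of 0 i] grid_mono[OF grid, of i "Suc i"] grid_mono[OF grid, of "Suc i" n] grid Suc.prems
    by (auto simp: is_grid_def)
  have X: "euler_scheme W b \<sigma> x \<tau> i \<in> borel_measurable ?F"
    using measurable_from_subalg[OF subalgebra_brownian_filtration_mono[OF \<tau>(2,3)] Suc.IH] Suc.prems by simp
  have [measurable]: "(\<lambda>\<omega>. W (\<tau> (Suc i)) \<omega> - W (\<tau> i) \<omega>) \<in> borel_measurable ?F"
    using \<tau> by (intro borel_measurable_diff measurable_W_brownian_filtration) auto
  have "(\<lambda>\<omega>. \<sigma> (euler_scheme W b \<sigma> x \<tau> i \<omega>) *v (W (\<tau> (Suc i)) \<omega> - W (\<tau> i) \<omega>)) \<in> borel_measurable ?F"
    by (intro borel_measurable_matrix_vector_mult measurable_compose[OF X \<sigma>]) simp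
  moreover have "(\<lambda>\<omega>. b (euler_scheme W b \<sigma> x \<tau> i \<omega>)) \<in> borel_measurable ?F"
    by (rule measurable_compose[OF X b])
  ultimately show ?case
    using X by simp
qed simp

text \<open>
  The constants \<open>m\<close> and \<open>C\<close> below do not involve \<open>N\<close>, \<open>R\<close>, \<open>n\<close> or the grid.
\<close>

lemma scheme_bound:
  fixes b :: "real ^ 'd \<Rightarrow> real ^ 'd" and \<sigma> :: "real ^ 'd \<Rightarrow> real ^ 'd ^ 'd"
    and F :: "real ^ 'd \<Rightarrow> real \<Rightarrow> real ^ 'd \<Rightarrow> real"
    and K L N R G :: real
  defines "d \<equiv> real CARD('d)"
  defines "m \<equiv> (1 + G) * exp (2 * L * T)"
  defines "\<kappa> \<equiv> 8 * L * d"
  defines "\<beta> \<equiv> 2 + 2 * \<kappa> * m"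
  defines "a \<equiv> 4 * \<beta> * d * exp (\<kappa> * m) / \<kappa>\<^sup>2"
  defines "C \<equiv> a * (exp (\<kappa> * m) + exp (\<kappa> * m) * \<kappa> * L * (1 + m) * T)"
  assumes grid: "is_grid T n \<tau>"
    and b: "b \<in> borel_measurable borel" and \<sigma>: "\<sigma> \<in> borel_measurable borel"
    and g: "\<And>x. \<bar>g x\<bar> \<le> G"
    and F_lip: "\<And>x1 x2 y1 y2 z1 z2.
      \<bar>F x1 y1 z1 - F x2 y2 z2\<bar> \<le> K * (norm (x1 - x2) + \<bar>y1 - y2\<bar>) + N * norm (z1 - z2)"
    and F_growth: "\<And>x y z. \<bar>F x y z\<bar> \<le> L * (1 + \<bar>y\<bar> + (norm z)\<^sup>2)"
    and L: "0 < L" and N: "0 \<le> N" and R: "0 \<le> R"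
    and small_L: "\<And>i. i < n \<Longrightarrow> step \<tau> i * L \<le> 1 / 2"
    and small_N: "\<And>i. i < n \<Longrightarrow> 2 * \<beta> * (step \<tau> i * N * (d * (R / sqrt (step \<tau> i)))) \<le> 1"
    and sol: "scheme_solution M W b \<sigma> g F x R n \<tau> Y Z"
  shows "AE \<omega> in M.
    (SUP i\<in>{..n}. ennreal \<bar>Y i \<omega>\<bar> +
      nn_cond_exp M (brownian_filtration M W (\<tau> i))
        (\<lambda>\<omega>'. ennreal (\<Sum>k=i..<n. (norm (Z k \<omega>'))\<^sup>2 * step \<tau> k)) \<omega>) \<le> ennreal (m + C)"
proof -
  define \<F> where "\<F> i = brownian_filtration M W (\<tau> i)" for i
  define h where "h i = step \<tau> i" for i
  define X where "X i = euler_scheme W b \<sigma> x \<tau> i" for i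
  define D where "D i \<omega> = F (X i \<omega>) (Y i \<omega>) (Z i \<omega>)" for i \<omega>
  have \<tau>0: "\<tau> 0 = 0" and \<tau>n: "\<tau> n = T" using grid by (auto simp: is_grid_def)
  have \<tau>_ge: "0 \<le> \<tau> i" and \<tau>_le: "\<tau> i \<le> T" if "i \<le> n" for i
    using grid_mono[OF grid, of 0 i] grid_mono[OF grid, of i n] that \<tau>0 \<tau>n by auto
  have T: "0 \<le> T" using \<tau>_ge[of n] \<tau>n by simp
  have G: "0 \<le> G" using g order_trans[OF abs_ge_zero] by blast
  have d: "0 < d" unfolding d_def by simp
  have \<kappa>: "0 < \<kappa>" unfolding \<kappa>_def using L d by simp
  have m: "0 \<le> m" unfolding m_def using G by simp
  have \<beta>: "2 \<le> \<beta>" unfolding \<beta>_def using \<kappa> m by simp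
  have a: "0 \<le> a" unfolding a_def using \<beta> d by simp
  have step_pos: "0 < h i" if "i < n" for i
    using grid that by (auto simp: h_def step_def is_grid_def)
  have sub: "subalgebra M (\<F> i)" if "i \<le> n" for i
    unfolding \<F>_def by (rule subalgebra_brownian_filtration[OF \<tau>_le[OF that]])
  have sub2: "subalgebra (\<F> j) (\<F> i)" if "i \<le> j" "j \<le> n" for i j
    unfolding \<F>_def using grid_mono[OF grid that] \<tau>_le[OF that(2)]
    by (intro subalgebra_brownian_filtration_mono)
  have cw: "conditional_weight M (\<F> i) (weight W R \<tau> i) (h i) (R / sqrt (h i))" if "i < n" for i
    unfolding \<F>_def h_def using \<tau>_ge[of i] \<tau>_le[of "Suc i"] grid R that
    by (intro conditional_weight_weight) (auto simp: is_grid_def)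

  have YF: "Y i \<in> borel_measurable (\<F> i)" and ZF: "Z i \<in> borel_measurable (\<F> i)"
    and Yint: "integrable M (Y i)" if "i \<le> n" for i
    using sol that unfolding scheme_solution_def \<F>_def by auto
  have YM: "Y i \<in> borel_measurable M" and ZM: "Z i \<in> borel_measurable M" if "i \<le> n" for i
    using measurable_from_subalg[OF sub[OF that]] YF[OF that] ZF[OF that] by auto
  have Yn: "AE \<omega> in M. Y n \<omega> = g (X n \<omega>)"
    using sol unfolding scheme_solution_def X_def by auto
  have Y_eq: "AE \<omega> in M. Y i \<omega> = real_cond_exp M (\<F> i) (\<lambda>\<omega>. Y (Suc i) \<omega> + h i * D i \<omega>) \<omega>" if "i < n" for i
    using sol that unfolding scheme_solution_def \<F>_def h_def D_def X_def by auto
  have Z_eq: "AE \<omega> in M. Z i \<omega> = (\<chi> l. real_cond_exp M (\<F> i) (\<lambda>\<omega>. Y (Suc i) \<omega> * weight W R \<tau> i \<omega> $ l) \<omega>)"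
    if "i < n" for i
    using sol that unfolding scheme_solution_def \<F>_def by auto

  have DF: "D i \<in> borel_measurable (\<F> i)" if "i \<le> n" for i
  proof -
    \<comment> \<open>Joint Lipschitz continuity gives Borel measurability of the driver, hence
      adaptedness of \<open>D i\<close>. No sign of \<open>K\<close> is assumed in this lemma,
      whence the absolute value.\<close>
    have "(2 * \<bar>K\<bar> + N)-lipschitz_on UNIV (\<lambda>(x, y, z). F x y z)"
    proof (rule lipschitz_onI)
      fix p q :: "(real ^ 'd) \<times> real \<times> (real ^ 'd)"
      obtain x1 y1 z1 x2 y2 z2 where pq: "p = (x1, y1, z1)" "q = (x2, y2, z2)"
        by (cases p, cases q)
      have x: "norm (x1 - x2) \<le> dist p q"
        using dist_fst_le[of p q] by (simp add: pq dist_norm)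
      have "dist (y1, z1) (y2, z2) \<le> dist p q"
        using dist_snd_le[of p q] by (simp add: pq)
      then have y: "\<bar>y1 - y2\<bar> \<le> dist p q" and z: "norm (z1 - z2) \<le> dist p q"
        using dist_fst_le[of "(y1, z1)" "(y2, z2)"] dist_snd_le[of "(y1, z1)" "(y2, z2)"]
        by (auto simp: dist_norm)
      have "\<bar>F x1 y1 z1 - F x2 y2 z2\<bar> \<le> \<bar>K\<bar> * (norm (x1 - x2) + \<bar>y1 - y2\<bar>) + N * norm (z1 - z2)"
        by (rule order_trans[OF F_lip]) (auto intro: mult_right_mono)
      also have "\<dots> \<le> \<bar>K\<bar> * (dist p q + dist p q) + N * dist p q"
        using x y z N by (intro add_mono mult_left_mono) auto
      finally show "dist (case p of (x, y, z) \<Rightarrow> F x y z) (case q of (x, y, z) \<Rightarrow> F x y z)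
          \<le> (2 * \<bar>K\<bar> + N) * dist p q"
        by (simp add: pq dist_real_def algebra_simps)
    qed (use N in simp)
    then have F: "(\<lambda>(x, y, z). F x y z) \<in> borel_measurable borel"
      by (rule lipschitz_on_borel_measurable)
    have "(\<lambda>\<omega>. (X i \<omega>, Y i \<omega>, Z i \<omega>)) \<in> borel_measurable (\<F> i)"
      using measurable_euler_scheme[OF b \<sigma> grid that] YF[OF that] ZF[OF that]
      unfolding X_def \<F>_def by (intro borel_measurable_Pair)
    from measurable_compose[OF this F] show ?thesis
      unfolding D_def by simp
  qed

  \<comment> \<open>The mixed estimate with free \<open>z\<close>: \<open>z = 0\<close> serves the
    bound on \<open>Y\<close>, and the small-increment part of \<open>Z\<close> the quadratic
    one.\<close>
  have D_growth: "\<bar>D i \<omega>\<bar> \<le> L * (1 + \<bar>Y i \<omega>\<bar> + (norm z)\<^sup>2) + N * norm (Z i \<omega> - z)" for i \<omega> z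
  proof -
    have "\<bar>D i \<omega> - F (X i \<omega>) (Y i \<omega>) z\<bar> \<le> N * norm (Z i \<omega> - z)"
      using F_lip[of "X i \<omega>" "Y i \<omega>" "Z i \<omega>" "X i \<omega>" "Y i \<omega>" z] unfolding D_def by simp
    with F_growth[of "X i \<omega>" "Y i \<omega>" z] show ?thesis by linarith
  qed

  \<comment> \<open>The weight estimate with \<open>c = h N\<close>. Its smallness condition is
    weaker than \<open>small_N\<close> by the factor \<open>2 \<beta> \<ge> 1\<close>.\<close>
  have Z_bound: "AE \<omega> in M. \<bar>real_cond_exp M (\<F> i) (Y (Suc i)) \<omega>\<bar> + h i * N * norm (Z i \<omega>) \<le> c"
    if i: "i < n" and c: "AE \<omega> in M. \<bar>Y (Suc i) \<omega>\<bar> \<le> c" for i c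
  proof -
    interpret conditional_weight M "\<F> i" "weight W R \<tau> i" "h i" "R / sqrt (h i)" by (rule cw[OF i])
    have "0 \<le> h i * N" using step_pos[OF i] N by simp
    moreover have "h i * N * (CARD('d) * (R / sqrt (h i))) \<le> 1"
    proof -
      let ?v = "h i * N * (d * (R / sqrt (h i)))"
      have "1 * ?v \<le> 2 * \<beta> * ?v"
        using \<beta> step_pos[OF i] N R d by (intro mult_right_mono mult_nonneg_nonneg) auto
      with small_N[OF i] show ?thesis unfolding h_def d_def by simp
    qed
    ultimately show ?thesis
      using cond_exp_plus_norm_proj_le[OF YM c, of "h i * N"] Z_eq[OF i] i by (auto elim: eventually_elim2)
  qed

  \<comment> \<open>The scheme conditions the sum, and splitting it requires \<open>D i\<close> to
    be integrable, which a solution does not state. \<open>Z_bound\<close> yields \<open>N\<close>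
    times the norm of \<open>Z\<close> below \<open>c / h\<close>; this may be huge, but only
    finiteness counts.\<close>
  have Y_step: "AE \<omega> in M. Y i \<omega> = real_cond_exp M (\<F> i) (Y (Suc i)) \<omega> + h i * D i \<omega>"
    if i: "i < n" and c: "AE \<omega> in M. \<bar>Y (Suc i) \<omega>\<bar> \<le> c" for i c
  proof -
    interpret conditional_weight M "\<F> i" "weight W R \<tau> i" "h i" "R / sqrt (h i)" by (rule cw[OF i])
    have DM: "D i \<in> borel_measurable M" using measurable_from_subalg[OF sub DF] i by simp
    have "integrable M (D i)"
    proof (rule Bochner_Integration.integrable_bound)
      show "integrable M (\<lambda>\<omega>. L * (1 + \<bar>Y i \<omega>\<bar>) + c / h i)"
        using Yint[of i] i by simp
      show "AE \<omega> in M. norm (D i \<omega>) \<le> norm (L * (1 + \<bar>Y i \<omega>\<bar>) + c / h i)"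
        using Z_bound[OF i c]
      proof eventually_elim
        case (elim \<omega>)
        then have "h i * (N * norm (Z i \<omega>)) \<le> c"
          by (simp add: mult.assoc abs_le_iff)
        then have "N * norm (Z i \<omega>) \<le> c / h i" using step_pos[OF i] by (simp add: field_simps)
        with D_growth[of i \<omega> 0] show ?case by simp
      qed
    qed (fact DM)
    then have int: "integrable M (\<lambda>\<omega>. h i * D i \<omega>)" by simp
    have "AE \<omega> in M. real_cond_exp M (\<F> i) (\<lambda>\<omega>. Y (Suc i) \<omega> + h i * D i \<omega>) \<omega>
        = real_cond_exp M (\<F> i) (Y (Suc i)) \<omega> + real_cond_exp M (\<F> i) (\<lambda>\<omega>. h i * D i \<omega>) \<omega>"
      using Yint[of "Suc i"] int i by (intro real_cond_exp_add) auto
    moreover have "AE \<omega> in M. real_cond_exp M (\<F> i) (\<lambda>\<omega>. h i * D i \<omega>) \<omega> = h i * D i \<omega>"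
      using int DF[of i] i by (intro real_cond_exp_F_meas) auto
    moreover note Y_eq[OF i]
    ultimately show ?thesis by eventually_elim simp
  qed

  \<comment> \<open>Solves \<open>1 + \<mu> i = exp (2 L h) (1 + \<mu> (i + 1))\<close> with
    \<open>\<mu> n = G\<close>. The rate is \<open>2 L\<close> because the implicit step costs
    \<open>1 / (1 - h L)\<close>, at most \<open>exp (2 h L)\<close> when
    \<open>h L \<le> 1 / 2\<close>.\<close>
  define \<mu> where "\<mu> i = (1 + G) * exp (2 * L * (T - \<tau> i)) - 1" for i
  have \<mu>_m: "\<mu> i \<le> m" if "i \<le> n" for i
  proof -
    have "exp (2 * L * (T - \<tau> i)) \<le> exp (2 * L * T)"
      using \<tau>_ge[OF that] L by simp
    then have "(1 + G) * exp (2 * L * (T - \<tau> i)) \<le> m"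
      unfolding m_def using G by (intro mult_left_mono) auto
    then show ?thesis unfolding \<mu>_def by simp
  qed
  have Y_\<mu>: "AE \<omega> in M. \<bar>Y i \<omega>\<bar> \<le> \<mu> i" if "i \<le> n" for i
    using that
  proof (induction rule: inc_induct)
    case base
    show ?case using Yn by eventually_elim (simp add: \<mu>_def \<tau>n g)
  next
    case (step i)
    have i: "i < n" by fact
    show ?case
      using Z_bound[OF i step.IH] Y_step[OF i step.IH]
    proof eventually_elim
      case (elim \<omega>)
      let ?e = "real_cond_exp M (\<F> i) (Y (Suc i)) \<omega>"
      have "h i * \<bar>D i \<omega>\<bar> \<le> h i * (L * (1 + \<bar>Y i \<omega>\<bar>) + N * norm (Z i \<omega>))"
        using D_growth[of i \<omega> 0] step_pos[OF i] by (intro mult_left_mono) auto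
      moreover have "\<bar>Y i \<omega>\<bar> \<le> \<bar>?e\<bar> + h i * \<bar>D i \<omega>\<bar>"
        using abs_triangle_ineq[of ?e "h i * D i \<omega>"] step_pos[OF i] unfolding elim(2)[symmetric] by (simp add: abs_mult)
      \<comment> \<open>The term with \<open>Z\<close> is absorbed by \<open>Z_bound\<close> at no
        cost, so \<open>N\<close> disappears; the implicit \<open>\<bar>Y i\<bar>\<close> coming
        from the driver moves to the left.\<close>
      ultimately have le: "(1 + \<bar>Y i \<omega>\<bar>) * (1 - h i * L) \<le> 1 + \<mu> (Suc i)"
        using elim(1) by (simp add: algebra_simps)
      have hL: "0 \<le> h i * L" "h i * L \<le> 1 / 2"
        using step_pos[OF i] L small_L[OF i] by (auto simp: h_def)
      have "1 \<le> (1 - h i * L) * (1 + 2 * (h i * L))"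
      proof -
        have "0 \<le> (h i * L) * (1 - 2 * (h i * L))" by (rule mult_nonneg_nonneg) (use hL in linarith)+
        then show ?thesis by (simp add: algebra_simps)
      qed
      also have "\<dots> \<le> (1 - h i * L) * exp (2 * (h i * L))"
        by (intro mult_left_mono exp_ge_add_one_self) (use hL in linarith)
      finally have "(1 + \<bar>Y i \<omega>\<bar>) * 1 \<le> (1 + \<bar>Y i \<omega>\<bar>) * ((1 - h i * L) * exp (2 * (h i * L)))"
        by (intro mult_left_mono) auto
      also have "\<dots> = ((1 + \<bar>Y i \<omega>\<bar>) * (1 - h i * L)) * exp (2 * (h i * L))"
        by simp
      also have "\<dots> \<le> (1 + \<mu> (Suc i)) * exp (2 * (h i * L))"
        using le by (intro mult_right_mono) auto
      also have "\<dots> = 1 + \<mu> i"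
        unfolding \<mu>_def h_def step_def by (simp add: algebra_simps flip: exp_add)
      finally show ?case by simp
    qed
  qed
  have Y_m: "AE \<omega> in M. \<bar>Y i \<omega>\<bar> \<le> m" if "i \<le> n" for i
    using Y_\<mu>[OF that] by eventually_elim (use \<mu>_m[OF that] in linarith)

  define \<phi> where "\<phi> i \<omega> = exp (\<kappa> * Y i \<omega>)" for i \<omega>
  define a' where "a' = exp (\<kappa> * m) * \<kappa> * L * (1 + m)"
  have Yb: "ess_bounded M (Y i)" if "i \<le> n" for i
    by (rule ess_boundedI[OF YM[OF that] Y_m[OF that]])
  have \<phi>b: "ess_bounded M (\<phi> i)" if "i \<le> n" for i
    unfolding \<phi>_def by (intro ess_bounded_intros Yb that)
  have \<phi>F: "\<phi> i \<in> borel_measurable (\<F> i)" if "i \<le> n" for i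
    unfolding \<phi>_def using YF[OF that] by simp
  have Z_step: "AE \<omega> in M. (norm (Z i \<omega>))\<^sup>2 * h i \<le> a * (real_cond_exp M (\<F> i) (\<phi> (Suc i)) \<omega> - \<phi> i \<omega> + a' * h i)"
    if i: "i < n" for i
  proof -
    interpret conditional_weight M "\<F> i" "weight W R \<tau> i" "h i" "R / sqrt (h i)" by (rule cw[OF i])
    have ii: "i \<le> n" "Suc i \<le> n" using i by auto
    have D_bd: "AE \<omega> in M. \<forall>z. \<bar>D i \<omega>\<bar> \<le> L * (1 + m + (norm z)\<^sup>2) + N * norm (Z i \<omega> - z)"
      using Y_m[OF ii(1)]
    proof eventually_elim
      case (elim \<omega>)
      show ?case
      proof
        fix z :: "real ^ 'd"
        have "L * (1 + \<bar>Y i \<omega>\<bar> + (norm z)\<^sup>2) \<le> L * (1 + m + (norm z)\<^sup>2)"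
          using elim L by (intro mult_left_mono) auto
        with D_growth[of i \<omega> z] show "\<bar>D i \<omega>\<bar> \<le> L * (1 + m + (norm z)\<^sup>2) + N * norm (Z i \<omega> - z)"
          by linarith
      qed
    qed
    have \<kappa>_eq: "\<kappa> = 8 * L * real CARD('d)" and \<beta>_eq: "\<beta> = 2 + 2 * \<kappa> * m"
      by (simp_all add: \<kappa>_def \<beta>_def d_def)
    from exp_submartingale_step[OF YM[OF ii(2)] Y_m[OF ii(2)] YF[OF ii(1)] Y_m[OF ii(1)] Z_eq[OF i]
        Y_step[OF i Y_m[OF ii(2)]] D_bd L N m \<kappa>_eq \<beta>_eq small_N[OF i, folded h_def, unfolded d_def]]
    show ?thesis
      unfolding \<phi>_def a_def a'_def d_def by (simp add: mult.commute[of "h i"])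
  qed
  \<comment> \<open>A solution carries no integrability of \<open>Z\<close>. It comes from
    \<open>Z_step\<close>, whose right side is bounded and whose left side is nonnegative.\<close>
  have Zb: "ess_bounded M (\<lambda>\<omega>. (norm (Z i \<omega>))\<^sup>2 * h i)" if i: "i < n" for i
  proof -
    interpret conditional_weight M "\<F> i" "weight W R \<tau> i" "h i" "R / sqrt (h i)" by (rule cw[OF i])
    have "ess_bounded M (\<lambda>\<omega>. a * (real_cond_exp M (\<F> i) (\<phi> (Suc i)) \<omega> - \<phi> i \<omega> + a' * h i))"
      using i by (intro ess_bounded_intros ess_bounded_cond_exp \<phi>b) auto
    then obtain c where "AE \<omega> in M. \<bar>a * (real_cond_exp M (\<F> i) (\<phi> (Suc i)) \<omega> - \<phi> i \<omega> + a' * h i)\<bar> \<le> c"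
      unfolding ess_bounded_def by blast
    with Z_step[OF i] have "AE \<omega> in M. \<bar>(norm (Z i \<omega>))\<^sup>2 * h i\<bar> \<le> c"
    proof eventually_elim
      case (elim \<omega>)
      have "0 \<le> (norm (Z i \<omega>))\<^sup>2 * h i" using step_pos[OF i] by simp
      with elim show ?case by linarith
    qed
    moreover have "(\<lambda>\<omega>. (norm (Z i \<omega>))\<^sup>2 * h i) \<in> borel_measurable M"
      using ZM[of i] i by simp
    ultimately show ?thesis by (intro ess_boundedI)
  qed

  \<comment> \<open>Telescoping with \<open>i\<close> fixed and the upper end growing: by the tower
    property the conditional means of \<open>\<phi>\<close> at intermediate times cancel, and the
    errors add up to \<open>a'\<close> times elapsed time, whatever the number of steps.\<close>
  have Z_sum: "AE \<omega> in M. real_cond_exp M (\<F> i) (\<lambda>\<omega>. \<Sum>k=i..<j. (norm (Z k \<omega>))\<^sup>2 * h k) \<omega>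
      \<le> a * (real_cond_exp M (\<F> i) (\<phi> j) \<omega> - \<phi> i \<omega> + a' * (\<tau> j - \<tau> i))"
    if "i \<le> j" "j \<le> n" for i j
    using that
  proof (induction rule: dec_induct)
    case base
    interpret finite_measure_subalgebra M "\<F> i" using base by unfold_locales (rule sub)
    have "AE \<omega> in M. real_cond_exp M (\<F> i) (\<lambda>\<omega>. 0) \<omega> = (0::real)"
      by (intro real_cond_exp_F_meas) auto
    moreover have "AE \<omega> in M. real_cond_exp M (\<F> i) (\<phi> i) \<omega> = \<phi> i \<omega>"
      using base by (intro real_cond_exp_F_meas ess_bounded_integrable \<phi>b \<phi>F) auto
    ultimately show ?case by eventually_elim simp
  next
    case (step j)
    have j: "j < n" "j \<le> n" "Suc j \<le> n" and ij: "i \<le> j" and i: "i \<le> n" using step by auto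
    interpret finite_measure_subalgebra M "\<F> i" using i by unfold_locales (rule sub)
    interpret Fj: finite_measure_subalgebra M "\<F> j" using j by unfold_locales (rule sub)
    let ?S = "\<lambda>\<omega>. \<Sum>k=i..<j. (norm (Z k \<omega>))\<^sup>2 * h k"
    let ?E = "real_cond_exp M (\<F> j) (\<phi> (Suc j))"
    have Sb: "ess_bounded M ?S" using j by (intro ess_bounded_sum Zb) auto
    have Eb: "ess_bounded M ?E" by (intro Fj.ess_bounded_cond_exp \<phi>b j)
    have "AE \<omega> in M. real_cond_exp M (\<F> i) (\<lambda>\<omega>. ?S \<omega> + (norm (Z j \<omega>))\<^sup>2 * h j) \<omega>
        = real_cond_exp M (\<F> i) ?S \<omega> + real_cond_exp M (\<F> i) (\<lambda>\<omega>. (norm (Z j \<omega>))\<^sup>2 * h j) \<omega>"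
      by (intro real_cond_exp_add ess_bounded_integrable Sb Zb j)
    moreover have "AE \<omega> in M. real_cond_exp M (\<F> i) (\<lambda>\<omega>. (norm (Z j \<omega>))\<^sup>2 * h j) \<omega>
        \<le> real_cond_exp M (\<F> i) (\<lambda>\<omega>. a * (?E \<omega> - \<phi> j \<omega> + a' * h j)) \<omega>"
      by (intro real_cond_exp_mono Z_step ess_bounded_integrable ess_bounded_intros Zb Eb \<phi>b j)
    moreover have "AE \<omega> in M. real_cond_exp M (\<F> i) (\<lambda>\<omega>. a * (?E \<omega> - \<phi> j \<omega> + a' * h j)) \<omega>
        = a * real_cond_exp M (\<F> i) (\<lambda>\<omega>. ?E \<omega> - \<phi> j \<omega> + a' * h j) \<omega>"
      by (intro real_cond_exp_cmult ess_bounded_integrable ess_bounded_intros Eb \<phi>b j)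
    moreover have "AE \<omega> in M. real_cond_exp M (\<F> i) (\<lambda>\<omega>. ?E \<omega> - \<phi> j \<omega> + a' * h j) \<omega>
        = real_cond_exp M (\<F> i) (\<lambda>\<omega>. ?E \<omega> - \<phi> j \<omega>) \<omega> + real_cond_exp M (\<F> i) (\<lambda>\<omega>. a' * h j) \<omega>"
      by (intro real_cond_exp_add ess_bounded_integrable ess_bounded_intros Eb \<phi>b j)
    moreover have "AE \<omega> in M. real_cond_exp M (\<F> i) (\<lambda>\<omega>. ?E \<omega> - \<phi> j \<omega>) \<omega>
        = real_cond_exp M (\<F> i) ?E \<omega> - real_cond_exp M (\<F> i) (\<phi> j) \<omega>"
      by (intro real_cond_exp_diff ess_bounded_integrable Eb \<phi>b j)
    moreover have "AE \<omega> in M. real_cond_exp M (\<F> i) (\<lambda>\<omega>. a' * h j) \<omega> = a' * h j"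
      by (intro real_cond_exp_F_meas) auto
    moreover have "AE \<omega> in M. real_cond_exp M (\<F> i) ?E \<omega> = real_cond_exp M (\<F> i) (\<phi> (Suc j)) \<omega>"
      by (intro real_cond_exp_nested_subalg sub sub2 ess_bounded_integrable \<phi>b j ij)
    moreover note step.IH[OF j(2)]
    ultimately show ?case
    proof eventually_elim
      case (elim \<omega>)
      let ?e = "\<lambda>j. real_cond_exp M (\<F> i) (\<phi> j) \<omega>"
      have "real_cond_exp M (\<F> i) (\<lambda>\<omega>. \<Sum>k=i..<Suc j. (norm (Z k \<omega>))\<^sup>2 * h k) \<omega>
          = real_cond_exp M (\<F> i) ?S \<omega> + real_cond_exp M (\<F> i) (\<lambda>\<omega>. (norm (Z j \<omega>))\<^sup>2 * h j) \<omega>"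
        using elim(1) ij by simp
      also have "\<dots> \<le> a * (?e j - \<phi> i \<omega> + a' * (\<tau> j - \<tau> i)) + a * (?e (Suc j) - ?e j + a' * h j)"
        using elim(2,8) unfolding elim(3-7) by (rule add_mono[rotated])
      also have "\<dots> = a * (?e (Suc j) - \<phi> i \<omega> + a' * (\<tau> (Suc j) - \<tau> i))"
        by (simp add: h_def step_def algebra_simps)
      finally show ?case .
    qed
  qed

  have C: "0 \<le> C"
    unfolding C_def using a \<kappa> L m T by simp
  have "AE \<omega> in M. ennreal \<bar>Y i \<omega>\<bar> + nn_cond_exp M (\<F> i) (\<lambda>\<omega>'. ennreal (\<Sum>k=i..<n. (norm (Z k \<omega>'))\<^sup>2 * h k)) \<omega>
      \<le> ennreal (m + C)" if i: "i \<le> n" for i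
  proof -
    interpret finite_measure_subalgebra M "\<F> i" using i by unfold_locales (rule sub)
    have "AE \<omega> in M. \<phi> n \<omega> \<le> exp (\<kappa> * m)"
      using Y_m[OF order_refl] by eventually_elim (use \<kappa> in \<open>auto simp: \<phi>_def\<close>)
    then have "AE \<omega> in M. real_cond_exp M (\<F> i) (\<phi> n) \<omega> \<le> exp (\<kappa> * m)"
      by (intro real_cond_exp_le_c ess_bounded_integrable \<phi>b) auto
    with Z_sum[OF i order_refl]
    have "AE \<omega> in M. real_cond_exp M (\<F> i) (\<lambda>\<omega>. \<Sum>k=i..<n. (norm (Z k \<omega>))\<^sup>2 * h k) \<omega> \<le> C"
    proof eventually_elim
      case (elim \<omega>)
      have "a' * (\<tau> n - \<tau> i) \<le> a' * T"
        using \<tau>_ge[OF i] \<tau>n \<kappa> L m unfolding a'_def by (intro mult_left_mono) auto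
      moreover have "0 < \<phi> i \<omega>" by (simp add: \<phi>_def)
      ultimately have "a * (real_cond_exp M (\<F> i) (\<phi> n) \<omega> - \<phi> i \<omega> + a' * (\<tau> n - \<tau> i)) \<le> a * (exp (\<kappa> * m) + a' * T)"
        using elim(2) a by (intro mult_left_mono) auto
      with elim(1) show ?case unfolding C_def a'_def by linarith
    qed
    moreover have "AE \<omega> in M. 0 \<le> (\<Sum>k=i..<n. (norm (Z k \<omega>))\<^sup>2 * h k)"
      using step_pos by (intro AE_I2 sum_nonneg mult_nonneg_nonneg) (auto intro: less_imp_le)
    ultimately have "AE \<omega> in M. nn_cond_exp M (\<F> i) (\<lambda>\<omega>. ennreal (\<Sum>k=i..<n. (norm (Z k \<omega>))\<^sup>2 * h k)) \<omega> \<le> ennreal C"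
      by (intro nn_cond_exp_le_of_real_cond_exp_le ess_bounded_sum Zb) auto
    moreover note Y_m[OF i]
    ultimately show ?thesis
    proof eventually_elim
      case (elim \<omega>)
      then show ?case
        using add_mono[OF ennreal_leI[OF elim(2)] elim(1)] m C by (simp add: ennreal_plus)
    qed
  qed
  then have "AE \<omega> in M. \<forall>i\<in>{..n}. ennreal \<bar>Y i \<omega>\<bar> + nn_cond_exp M (\<F> i) (\<lambda>\<omega>'. ennreal (\<Sum>k=i..<n. (norm (Z k \<omega>'))\<^sup>2 * h k)) \<omega>
      \<le> ennreal (m + C)"
    by (intro AE_finite_allI) auto
  then show ?thesis
    unfolding \<F>_def h_def by eventually_elim (rule SUP_least, blast)
qed

end

section \<open>The truncated driver and the choice of constants\<close>

text \<open>The projection is nonexpansive and fixes the centre \<open>0\<close>.\<close>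

lemma norm_closest_point_cball_le:
  fixes z :: "'a::euclidean_space"
  assumes "0 \<le> r"
  shows "norm (closest_point (cball 0 r) z) \<le> norm z"
proof -
  have "dist (closest_point (cball 0 r) z) (closest_point (cball 0 r) 0) \<le> dist z (0 :: 'a)"
    using assms by (intro closest_point_lipschitz) auto
  then show ?thesis
    using assms by (simp add: closest_point_self)
qed

lemma truncated_driver_lipschitz:
  assumes "\<And>x1 x2 y1 y2 z. \<bar>f x1 y1 z - f x2 y2 z\<bar> \<le> K * (norm (x1 - x2) + \<bar>y1 - y2\<bar>)"
    and "\<And>x y. N-lipschitz_on UNIV (truncated_driver f \<rho> N x y)"
  shows "\<bar>truncated_driver f \<rho> N x1 y1 z1 - truncated_driver f \<rho> N x2 y2 z2\<bar>
    \<le> K * (norm (x1 - x2) + \<bar>y1 - y2\<bar>) + N * norm (z1 - z2)"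
proof -
  have "\<bar>truncated_driver f \<rho> N x1 y1 z1 - truncated_driver f \<rho> N x2 y2 z1\<bar> \<le> K * (norm (x1 - x2) + \<bar>y1 - y2\<bar>)"
    unfolding truncated_driver_def by (rule assms(1))
  moreover have "\<bar>truncated_driver f \<rho> N x2 y2 z1 - truncated_driver f \<rho> N x2 y2 z2\<bar> \<le> N * norm (z1 - z2)"
    using lipschitz_onD[OF assms(2), of z1 z2] by (simp add: dist_norm)
  ultimately show ?thesis by linarith
qed

text \<open>The constant stays \<open>L\<close> for every \<open>N\<close>, which keeps the final
  constant independent of \<open>n\<close>; \<open>N\<close> enters only through the Lipschitz bound
  in \<open>z\<close>.\<close>

lemma truncated_driver_growth:
  assumes "\<And>x y z. \<bar>f x y z\<bar> \<le> L * (1 + \<bar>y\<bar> + (norm z)\<^sup>2)" and "0 \<le> L" and "0 \<le> \<rho> * N"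
  shows "\<bar>truncated_driver f \<rho> N x y z\<bar> \<le> L * (1 + \<bar>y\<bar> + (norm z)\<^sup>2)"
proof -
  have "(norm (closest_point (cball 0 (\<rho> * N)) z))\<^sup>2 \<le> (norm z)\<^sup>2"
    by (intro power_mono norm_closest_point_cball_le assms) simp
  then have "L * (1 + \<bar>y\<bar> + (norm (closest_point (cball 0 (\<rho> * N)) z))\<^sup>2) \<le> L * (1 + \<bar>y\<bar> + (norm z)\<^sup>2)"
    using assms(2) by (intro mult_left_mono) auto
  with assms(1) show ?thesis
    unfolding truncated_driver_def by (rule order_trans)
qed

text \<open>With \<open>nn_cond_exp\<close> and a supremum of extended reals, finiteness of the
  conditional sums is part of the claim instead of a prerequisite.\<close>

theorem corollary2p8:
  fixes M :: "'a measure" and W :: "real \<Rightarrow> 'a \<Rightarrow> real ^ 'd"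
    and T K L \<rho> c1 c2 \<theta> \<alpha> :: real
    and b :: "real ^ 'd \<Rightarrow> real ^ 'd" and \<sigma> :: "real ^ 'd \<Rightarrow> real ^ 'd ^ 'd"
    and g :: "real ^ 'd \<Rightarrow> real" and f :: "real ^ 'd \<Rightarrow> real \<Rightarrow> real ^ 'd \<Rightarrow> real"
    and t :: "nat \<Rightarrow> nat \<Rightarrow> real" and x :: "real ^ 'd"
  assumes "T > 0" and "K > 0" and "L > 0"
    and "brownian_motion M W T"
    and "K-lipschitz_on UNIV b" and "K-lipschitz_on UNIV \<sigma>"
    and "bounded (range g)" and "K-lipschitz_on UNIV g"
    and "\<And>x1 x2 y1 y2 z. \<bar>f x1 y1 z - f x2 y2 z\<bar> \<le> K * (norm (x1 - x2) + \<bar>y1 - y2\<bar>)"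
    and "\<And>x y z z'. \<bar>f x y z - f x y z'\<bar> \<le> L * (1 + norm z + norm z') * norm (z - z')"
    and "\<And>x y z. \<bar>f x y z\<bar> \<le> L * (1 + \<bar>y\<bar> + (norm z)\<^sup>2)"
    and "\<rho> > 0"
    and "\<forall>\<^sub>F N in at_top. \<forall>x y. N-lipschitz_on UNIV (truncated_driver f \<rho> N x y)"
    and "c1 > 0" and "c2 > 0" and "\<theta> \<ge> 1"
    and "\<And>n. n \<ge> 1 \<Longrightarrow> is_grid T n (t n)"
    and "\<And>n. n \<ge> 1 \<Longrightarrow> mesh n (t n) * real n \<le> c1"
    and "\<And>n i. i < n \<Longrightarrow> step (t n) i * real n powr \<theta> \<ge> c2"
    and "0 < \<alpha>" and "\<alpha> < 1 / 2"
  shows "\<exists>C::real. \<forall>\<^sub>F n in sequentially. \<forall>Y Z.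
    scheme_solution M W b \<sigma> g (truncated_driver f \<rho> (real n powr \<alpha>)) x (ln (real n)) n (t n) Y Z
    \<longrightarrow> (AE \<omega> in M.
          (SUP i\<in>{..n}. ennreal \<bar>Y i \<omega>\<bar> +
             nn_cond_exp M (brownian_filtration M W (t n i))
               (\<lambda>\<omega>'. ennreal (\<Sum>k=i..<n. (norm (Z k \<omega>'))\<^sup>2 * step (t n) k)) \<omega>)
          \<le> ennreal C)"
proof -
  interpret brownian_motion M W T by fact
  obtain G where g: "\<And>x. \<bar>g x\<bar> \<le> G"
    using \<open>bounded (range g)\<close> by (auto simp: bounded_iff)
  define d where "d = real CARD('d)"
  define m where "m = (1 + G) * exp (2 * L * T)"
  define \<kappa> where "\<kappa> = 8 * L * d"
  define \<beta> where "\<beta> = 2 + 2 * \<kappa> * m"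
  define C where "C = m + 4 * \<beta> * d * exp (\<kappa> * m) / \<kappa>\<^sup>2 *
    (exp (\<kappa> * m) + exp (\<kappa> * m) * \<kappa> * L * (1 + m) * T)"
  have G: "0 \<le> G" using g order_trans[OF abs_ge_zero] by blast
  have d: "0 < d" unfolding d_def by simp
  have \<beta>: "2 \<le> \<beta>" unfolding \<beta>_def \<kappa>_def m_def using G d \<open>L > 0\<close> by simp
  have \<alpha>: "filterlim (\<lambda>n. real n powr \<alpha>) at_top sequentially"
    using \<open>0 < \<alpha>\<close> by real_asymp
  \<comment> \<open>The Lipschitz property is given only for large \<open>N\<close>; it transfers to
    large \<open>n\<close> because \<open>N = n^\<alpha>\<close> tends to infinity.\<close>
  have lip: "\<forall>\<^sub>F n in sequentially. \<forall>x y. (real n powr \<alpha>)-lipschitz_on UNIV (truncated_driver f \<rho> (real n powr \<alpha>) x y)"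
    by (rule eventually_compose_filterlim[OF assms(13) \<alpha>])
  have small_h: "\<forall>\<^sub>F n in sequentially. c1 / real n * L < 1 / 2"
    by (rule order_tendstoD(2)[OF tendsto_mult_left_zero[OF lim_const_over_n]]) simp
  have small_N: "\<forall>\<^sub>F n in sequentially. sqrt (c1 / real n) * real n powr \<alpha> * ln (real n) \<le> 1 / (2 * \<beta> * d)"
  proof -
    \<comment> \<open>Here \<open>\<alpha> < 1 / 2\<close> enters: \<open>N sqrt h\<close> is at
      most of order \<open>n\<close> to the power \<open>- \<epsilon>\<close>, which beats the
      logarithm \<open>R\<close>.\<close>
    define \<epsilon> where "\<epsilon> = 1 / 2 - \<alpha>"
    have \<epsilon>: "0 < \<epsilon>" using \<open>\<alpha> < 1 / 2\<close> by (simp add: \<epsilon>_def)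
    have "(\<lambda>n. real n powr (- \<epsilon>) * ln (real n)) \<longlonglongrightarrow> 0"
      using \<epsilon> by real_asymp
    then have "(\<lambda>n. sqrt c1 * (real n powr (- \<epsilon>) * ln (real n))) \<longlonglongrightarrow> 0"
      by (rule tendsto_mult_right_zero)
    moreover have "0 < 1 / (2 * \<beta> * d)" using \<beta> d by simp
    ultimately have "\<forall>\<^sub>F n in sequentially. sqrt c1 * (real n powr (- \<epsilon>) * ln (real n)) < 1 / (2 * \<beta> * d)"
      by (rule order_tendstoD(2))
    then show ?thesis
      using eventually_gt_at_top[of 0]
    proof eventually_elim
      case (elim n)
      have "- \<epsilon> = \<alpha> + - (1 / 2)" by (simp add: \<epsilon>_def)
      then have "real n powr (- \<epsilon>) = real n powr \<alpha> * real n powr (- (1 / 2))"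
        by (simp only: powr_add)
      also have "real n powr (- (1 / 2)) = inverse (sqrt (real n))"
        by (simp only: powr_minus powr_half_sqrt of_nat_0_le_iff)
      finally have eq: "real n powr (- \<epsilon>) = real n powr \<alpha> * inverse (sqrt (real n))" .
      have "sqrt (c1 / real n) * real n powr \<alpha> * ln (real n) = sqrt c1 * (real n powr (- \<epsilon>) * ln (real n))"
        unfolding eq real_sqrt_divide unfolding divide_inverse by (simp only: mult_ac)
      also have "\<dots> \<le> 1 / (2 * \<beta> * d)" using elim(1) by (rule less_imp_le)
      finally show ?case .
    qed
  qed
  have "\<forall>\<^sub>F n in sequentially. \<forall>Y Z.
    scheme_solution M W b \<sigma> g (truncated_driver f \<rho> (real n powr \<alpha>)) x (ln (real n)) n (t n) Y Z
    \<longrightarrow> (AE \<omega> in M.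
          (SUP i\<in>{..n}. ennreal \<bar>Y i \<omega>\<bar> +
             nn_cond_exp M (brownian_filtration M W (t n i))
               (\<lambda>\<omega>'. ennreal (\<Sum>k=i..<n. (norm (Z k \<omega>'))\<^sup>2 * step (t n) k)) \<omega>)
          \<le> ennreal C)"
    using lip small_h small_N eventually_ge_at_top[of 1]
  proof eventually_elim
    case (elim n)
    define N where "N = real n powr \<alpha>"
    define R where "R = ln (real n)"
    have N: "0 \<le> N" and R: "0 \<le> R"
      using elim(4) by (auto simp: N_def R_def)
    have grid: "is_grid T n (t n)" using assms(17) elim(4) by blast
    have step: "0 < step (t n) i" "step (t n) i \<le> c1 / real n" if "i < n" for i
    proof -
      show "0 < step (t n) i" using grid that by (auto simp: is_grid_def step_def)
      have "step (t n) i \<le> mesh n (t n)"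
        unfolding mesh_def using that by (intro Max_ge) auto
      also have "\<dots> \<le> c1 / real n"
        using assms(18)[OF elim(4)] elim(4) by (simp add: field_simps)
      finally show "step (t n) i \<le> c1 / real n" .
    qed
    have small_L: "step (t n) i * L \<le> 1 / 2" if "i < n" for i
      using mult_right_mono[OF step(2)[OF that], of L] elim(2) \<open>L > 0\<close> by linarith
    have small_N: "2 * \<beta> * (step (t n) i * N * (d * (R / sqrt (step (t n) i)))) \<le> 1" if "i < n" for i
    proof -
      \<comment> \<open>The weight bound \<open>R / sqrt h\<close> grows as the step shrinks, but it
        occurs only multiplied by \<open>h\<close>. The product \<open>R sqrt h\<close> is
        increasing in \<open>h\<close>, so the upper bound \<open>c1 / n\<close> on the step is
        enough.\<close>
      have "2 * \<beta> * (step (t n) i * N * (d * (R / sqrt (step (t n) i))))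
          = 2 * \<beta> * d * (step (t n) i / sqrt (step (t n) i) * N * R)"
        by simp
      also have "step (t n) i / sqrt (step (t n) i) = sqrt (step (t n) i)"
        by (rule real_div_sqrt) (use step(1)[OF that] in simp)
      also have "2 * \<beta> * d * (sqrt (step (t n) i) * N * R) \<le> 2 * \<beta> * d * (sqrt (c1 / real n) * N * R)"
        using step(2)[OF that] N R \<beta> d by (intro mult_left_mono mult_right_mono real_sqrt_le_mono) auto
      also have "\<dots> \<le> 2 * \<beta> * d * (1 / (2 * \<beta> * d))"
        using elim(3) \<beta> d unfolding N_def R_def by (intro mult_left_mono) auto
      also have "\<dots> = 1" using \<beta> d by simp
      finally show ?thesis .
    qed
    show ?case
    proof (intro allI impI, fold N_def R_def)
      fix Y Z
      assume sol: "scheme_solution M W b \<sigma> g (truncated_driver f \<rho> N) x R n (t n) Y Z"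
      show "AE \<omega> in M.
          (SUP i\<in>{..n}. ennreal \<bar>Y i \<omega>\<bar> +
             nn_cond_exp M (brownian_filtration M W (t n i))
               (\<lambda>\<omega>'. ennreal (\<Sum>k=i..<n. (norm (Z k \<omega>'))\<^sup>2 * step (t n) k)) \<omega>)
          \<le> ennreal C"
        unfolding C_def \<beta>_def \<kappa>_def m_def d_def
      proof (rule scheme_bound[OF grid])
        show "b \<in> borel_measurable borel" "\<sigma> \<in> borel_measurable borel"
          using assms(5,6) by (auto intro: lipschitz_on_borel_measurable)
        show "\<bar>truncated_driver f \<rho> N x1 y1 z1 - truncated_driver f \<rho> N x2 y2 z2\<bar>
            \<le> K * (norm (x1 - x2) + \<bar>y1 - y2\<bar>) + N * norm (z1 - z2)" for x1 x2 y1 y2 z1 z2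
          using assms(9) elim(1) by (intro truncated_driver_lipschitz) (auto simp: N_def)
        show "\<bar>truncated_driver f \<rho> N x y z\<bar> \<le> L * (1 + \<bar>y\<bar> + (norm z)\<^sup>2)" for x y z
          using assms(11) \<open>L > 0\<close> \<open>\<rho> > 0\<close> N by (intro truncated_driver_growth) auto
      qed (use sol small_L small_N g N R \<open>L > 0\<close> in \<open>simp_all add: \<beta>_def \<kappa>_def m_def d_def\<close>)
    qed
  qed
  then show ?thesis by blast
qed

end
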